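(* Let $\varphi:\mathbb R\to\mathbb R$ be a continuous positive $1$-periodic function such that $N:=\int_0^1\varphi(t)\,dt$ is an integer $\ge2$ and $\varphi(x)>1$ for all $x$. Let $\sigma:\mathbb T\to\mathbb T$, $\sigma(e^{2\pi ix})=e^{2\pi i\int_0^x\varphi(t)\,dt}$, let $\psi(e^{2\pi ix})=1/\varphi(x)$, assume $\sum_{\sigma(w)=z}\psi(w)=1$ for all $z\in\mathbb T$, let $m\in C(\mathbb T)$ be a $\psi$-filter, let $\mathfrak u(e^{2\pi ix})=m(e^{2\pi ix})/\sqrt{\varphi(x)}$ and $D=|\mathfrak u|^2$. Let $r_k\in[0,1)$ satisfy $\int_0^{r_k}\varphi(t)\,dt=k$ for $k=1,\dots,N-1$, and let $r=\min\{r_1,1-r_{N-1}\}$. Assume that $|\mathfrak u(1)|=1$, that $\mathfrak u(e^{2\pi ix})\ne0$ if $|x|<r$, and that $\ln|\mathfrak u(e^{2\pi ix})|^2=O(x)$ for $x$ near $0$. Let $\mu$ be normalized Lebesgue (Hausdorff) measure on $\mathbb T$, let $\hat\iota=(\mu,\mathbb T*\mathbb C,\hat\iota)$ be the standard fundamental representation of $G(\mathbb T,\sigma)$, and let $L^2(\mathbb T_\infty,\mu_\infty)$ and the unitary $\tilde U_{\mathfrak u}$ be the Hilbert space of the induced representation of the pullback groupoid $G_\infty(\mathbb T,\sigma)$ (induced via $D$) and the image of $U_{\mathfrak u}$, as described in the context. Then there is an isometric isomorphism $R:L^2(\mathbb T_\infty,\mu_\infty)\to L^2(\mathbb R)$ that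 intertwines the unitary $\tilde U_{\mathfrak u}$ and the unitary $\mathfrak U_{\mathfrak u}$ on $L^2(\mathbb R)$ defined by $$\mathfrak U_{\mathfrak u}(\xi)(x)=\sqrt{\varphi(x)}\;\xi\Big(\int_0^x\varphi(t)\,dt\Big),\qquad \xi\in L^2(\mathbb R),$$ i.e. $R\tilde U_{\mathfrak u}=\mathfrak U_{\mathfrak u}R$.
   Context: A $\psi$-filter is a function $m\in C(\mathbb T)$ (complex valued) with $\sum_{\sigma(w)=z}\psi(w)|m(w)|^2=1$ for all $z\in\mathbb T$; thus $\sum_{\sigma(w)=z}D(w)=1$. $\mathbb T_\infty=\{\underline z=(z_n)_{n\ge0}\in\mathbb T^{\mathbb N}:\sigma(z_{n+1})=z_n\}$, $p(\underline z)=z_0$, $\sigma_\infty(\underline z)=(\sigma(z_0),z_0,z_1,\dots)$. For $z\in\mathbb T$, $\nu_z^D$ is the probability measure on $\mathbb T_\infty$, supported in $p^{-1}(z)$, with $$\int f_0(z_0)\cdots f_n(z_n)\,d\nu_z^D=\big(f_0\mathcal L_D(f_1\mathcal L_D(\cdots\mathcal L_D(f_n)\cdots))\big)(z),\quad f_i\in C(\mathbb T),$$ where $\mathcal L_D(f)(z)=\sum_{\sigma(w)=z}D(w)f(w)$. The standard fundamental representation is the trivial representation $\hat\iota_\gamma=1$ of the Deaconu–Renault groupoid $G(\mathbb T,\sigma)$ on the trivial line bundle over $(\mathbb T,\mu)$. The Hilbert space of the representation induced from it to the pullback groupoid of $G(\mathbb T,\sigma)$ along $p$, using the system $\nu^D$,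 is $L^2(\mathbb T_\infty,\mu_\infty)$ with $\mu_\infty=\int_{\mathbb T}\nu_z^D\,d\mu(z)$, and the unitary $\tilde U_{\mathfrak u}$ is $$\tilde U_{\mathfrak u}(\xi)(\underline z)=m(p(\underline z))\,\xi(\sigma_\infty(\underline z)),\qquad \xi\in L^2(\mathbb T_\infty,\mu_\infty).$$
   Formalization: The unitarity of Ũ_u on L²(T_∞, μ_∞) is an explicit hypothesis: it does not follow from the other assumptions (it fails for φ=3, D=max(0,1−3|x|), where m vanishes on an arc) and is necessary for the conclusion. *)

theory Defs
  imports "HOL-Probability.Probability" "HOL-Library.Landau_Symbols"
begin

section \<open>The Hilbert space of square-integrable functions modulo null sets\<close>

definition sq_integrable :: "'a measure \<Rightarrow> ('a \<Rightarrow> complex) set" where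
  "sq_integrable M = {f \<in> borel_measurable M. integrable M (\<lambda>x. (cmod (f x))\<^sup>2)}"

definition ae_eq :: "'a measure \<Rightarrow> (('a \<Rightarrow> complex) \<times> ('a \<Rightarrow> complex)) set" where
  "ae_eq M = {(f, g). f \<in> sq_integrable M \<and> g \<in> sq_integrable M \<and> (AE x in M. f x = g x)}"

definition L2 :: "'a measure \<Rightarrow> ('a \<Rightarrow> complex) set set" where
  "L2 M = sq_integrable M // ae_eq M"

definition L2_class :: "'a measure \<Rightarrow> ('a \<Rightarrow> complex) \<Rightarrow> ('a \<Rightarrow> complex) set" where
  "L2_class M f = ae_eq M `` {f}"

text \<open>
  Operations on classes are lifted from representatives by taking the union over all
  representatives of the resulting classes; when the operation respects equality almost
  everywhere, this union is the single resulting class.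
\<close>

definition L2_add ::
  "'a measure \<Rightarrow> ('a \<Rightarrow> complex) set \<Rightarrow> ('a \<Rightarrow> complex) set \<Rightarrow> ('a \<Rightarrow> complex) set" where
  "L2_add M A B = (\<Union>f\<in>A. \<Union>g\<in>B. L2_class M (\<lambda>x. f x + g x))"

definition L2_scale ::
  "'a measure \<Rightarrow> complex \<Rightarrow> ('a \<Rightarrow> complex) set \<Rightarrow> ('a \<Rightarrow> complex) set" where
  "L2_scale M c A = (\<Union>f\<in>A. L2_class M (\<lambda>x. c * f x))"

definition L2_norm :: "'a measure \<Rightarrow> ('a \<Rightarrow> complex) set \<Rightarrow> real" where
  "L2_norm M A = the_elem ((\<lambda>f. sqrt (LINT x|M. (cmod (f x))\<^sup>2)) ` A)"

definition L2_isometric_iso ::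
  "'a measure \<Rightarrow> 'b measure \<Rightarrow> (('a \<Rightarrow> complex) set \<Rightarrow> ('b \<Rightarrow> complex) set) \<Rightarrow> bool" where
  "L2_isometric_iso M M' R \<longleftrightarrow>
     bij_betw R (L2 M) (L2 M') \<and>
     (\<forall>A\<in>L2 M. \<forall>B\<in>L2 M. R (L2_add M A B) = L2_add M' (R A) (R B)) \<and>
     (\<forall>c. \<forall>A\<in>L2 M. R (L2_scale M c A) = L2_scale M' c (R A)) \<and>
     (\<forall>A\<in>L2 M. L2_norm M' (R A) = L2_norm M A)"

definition L2_unitary ::
  "'a measure \<Rightarrow> (('a \<Rightarrow> complex) set \<Rightarrow> ('a \<Rightarrow> complex) set) \<Rightarrow> bool" where
  "L2_unitary M U \<longleftrightarrow> L2_isometric_iso M M U"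


section \<open>The circle, filters and transfer operators\<close>

abbreviation circle :: "complex set" where
  "circle \<equiv> sphere 0 1"

definition circle_measure :: "complex measure" where
  "circle_measure =
     distr (restrict_space lborel {0..<1}) (restrict_space borel circle) (\<lambda>t. cis (2 * pi * t))"

text \<open>The interval integral is oriented, so this is also the intended value for negative \<open>x\<close>.\<close>

definition primitive :: "(real \<Rightarrow> real) \<Rightarrow> real \<Rightarrow> real" where
  "primitive \<phi> x = (LBINT t=ereal 0..ereal x. \<phi> t)"

definition preimages :: "(complex \<Rightarrow> complex) \<Rightarrow> complex \<Rightarrow> complex set" where
  "preimages \<sigma> z = {w \<in> circle. \<sigma> w = z}"

definition psi_filter ::
  "(complex \<Rightarrow> complex) \<Rightarrow> (complex \<Rightarrow> real) \<Rightarrow> (complex \<Rightarrow> complex) \<Rightarrow> bool" where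
  "psi_filter \<sigma> \<psi> m \<longleftrightarrow>
     continuous_on circle m \<and>
     (\<forall>z\<in>circle. (\<Sum>w\<in>preimages \<sigma> z. \<psi> w * (cmod (m w))\<^sup>2) = 1)"

definition transfer_op ::
  "(complex \<Rightarrow> complex) \<Rightarrow> (complex \<Rightarrow> real) \<Rightarrow> (complex \<Rightarrow> complex) \<Rightarrow> complex \<Rightarrow> complex" where
  "transfer_op \<sigma> D f z = (\<Sum>w\<in>preimages \<sigma> z. complex_of_real (D w) * f w)"

text \<open>\<open>iterated_transfer \<sigma> D f n\<close> is \<open>f\<^sub>0 L(f\<^sub>1 L(\<dots> L(f\<^sub>n) \<dots>))\<close> with \<open>L = transfer_op \<sigma> D\<close>.\<close>

primrec iterated_transfer ::
  "(complex \<Rightarrow> complex) \<Rightarrow> (complex \<Rightarrow> real) \<Rightarrow> (nat \<Rightarrow> complex \<Rightarrow> complex) \<Rightarrow> nat \<Rightarrow>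
   complex \<Rightarrow> complex" where
  "iterated_transfer \<sigma> D f 0 = f 0"
| "iterated_transfer \<sigma> D f (Suc n) =
     (\<lambda>z. f 0 z * transfer_op \<sigma> D (iterated_transfer \<sigma> D (\<lambda>i. f (Suc i)) n) z)"


section \<open>The projective limit and its path measures\<close>

definition solenoid :: "(complex \<Rightarrow> complex) \<Rightarrow> (nat \<Rightarrow> complex) set" where
  "solenoid \<sigma> = {\<zeta>. \<forall>n. \<zeta> n \<in> circle \<and> \<sigma> (\<zeta> (Suc n)) = \<zeta> n}"

definition solenoid_proj :: "(nat \<Rightarrow> complex) \<Rightarrow> complex" where
  "solenoid_proj \<zeta> = \<zeta> 0"

definition solenoid_map :: "(complex \<Rightarrow> complex) \<Rightarrow> (nat \<Rightarrow> complex) \<Rightarrow> nat \<Rightarrow> complex" where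
  "solenoid_map \<sigma> \<zeta> = case_nat (\<sigma> (\<zeta> 0)) \<zeta>"

text \<open>
  Here \<open>borel\<close> is the Borel algebra of the product topology on sequences, so its restriction
  is the Borel algebra of the compact space \<open>solenoid \<sigma>\<close>.
\<close>

definition is_path_measure ::
  "(complex \<Rightarrow> complex) \<Rightarrow> (complex \<Rightarrow> real) \<Rightarrow> complex \<Rightarrow> (nat \<Rightarrow> complex) measure \<Rightarrow> bool" where
  "is_path_measure \<sigma> D z P \<longleftrightarrow>
     prob_space P \<and>
     sets P = sets (restrict_space borel (solenoid \<sigma>)) \<and>
     (AE \<zeta> in P. solenoid_proj \<zeta> = z) \<and>
     (\<forall>n f. (\<forall>i. continuous_on circle (f i)) \<longrightarrow>
        (LINT \<zeta>|P. (\<Prod>i\<le>n. f i (\<zeta> i))) = iterated_transfer \<sigma> D f n z)"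


section \<open>The two operators\<close>

definition U_tilde ::
  "(nat \<Rightarrow> complex) measure \<Rightarrow> (complex \<Rightarrow> complex) \<Rightarrow> (complex \<Rightarrow> complex) \<Rightarrow>
   ((nat \<Rightarrow> complex) \<Rightarrow> complex) set \<Rightarrow> ((nat \<Rightarrow> complex) \<Rightarrow> complex) set" where
  "U_tilde M \<sigma> m A =
     (\<Union>\<xi>\<in>A. L2_class M (\<lambda>\<zeta>. m (solenoid_proj \<zeta>) * \<xi> (solenoid_map \<sigma> \<zeta>)))"

definition U_line :: "(real \<Rightarrow> real) \<Rightarrow> (real \<Rightarrow> complex) set \<Rightarrow> (real \<Rightarrow> complex) set" where
  "U_line \<phi> A =
     (\<Union>\<xi>\<in>A. L2_class lborel (\<lambda>x. complex_of_real (sqrt (\<phi> x)) * \<xi> (primitive \<phi> x)))"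

end

theory Submission
  imports Defs
begin

text \<open>
  Write \<open>\<Phi> x = \<integral>\<^sub>0\<^sup>x \<phi>\<close>, so that \<open>\<sigma>\<close> lifts to the expanding homeomorphism \<open>\<Phi>\<close> of the
  line, whose inverse \<open>\<tau>\<close> contracts to its fixed point \<open>0\<close>. Backward \<open>\<tau>\<close>-orbits wind the
  line into the solenoid by \<open>h x = (e x, e (\<tau> x), e (\<tau>\<^sup>2 x), \<dots>)\<close>, where
  \<open>e x = exp (2 \<pi> i x)\<close> (\<open>line_path\<close>, with \<open>turn\<close> for \<open>e\<close>). This map is injective with a
  Borel left inverse, and it carries \<open>\<Phi>\<close> to \<open>\<sigma>\<^sub>\<infinity>\<close>. The whole theorem comes from the fact
  that \<open>\<mu>\<^sub>\<infinity>\<close> lives on the image of \<open>h\<close>: \<open>\<mu>\<^sub>\<infinity> = h\<^sub>*(P dx)\<close> with density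
  \<open>P x = \<Prod>\<^sub>n\<^sub>\<ge>\<^sub>1 D (e (\<tau>\<^sup>n x))\<close> (\<open>mass\<close>; the formula is \<open>emeasure_mu_sol\<close>).

  Evaluating the path measure \<open>\<nu>\<^sub>z\<close>, \<open>z = e x\<close>, on cylinders shows that it gives the
  point \<open>h (x + k)\<close> the mass \<open>P (x + k)\<close>, for each integer \<open>k\<close>. So the formula for \<open>\<mu>\<^sub>\<infinity>\<close>
  says that the 1-periodic function \<open>Q x = \<Sum>\<^sub>k P (x + k) \<le> 1\<close> (\<open>line_prob\<close>) is
  identically 1 (\<open>line_prob_1\<close>). The relation \<open>P (\<Phi> x) = D (e x) P x\<close> makes \<open>Q\<close> a fixed
  point of the transfer operator of \<open>D\<close>. If \<open>\<alpha>\<close> is the infimum of \<open>Q\<close>, then following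
  one branch of preimages for \<open>n\<close> steps gives
  \<open>Q y - \<alpha> \<ge> (\<Prod>\<^sub>1\<^sub>\<le>\<^sub>i\<^sub>\<le>\<^sub>n D (e (\<tau>\<^sup>i y))) (Q (\<tau>\<^sup>n y) - \<alpha>)\<close>. The condition \<open>u \<noteq> 0\<close> on
  \<open>(-r, r)\<close> is what lets every residue class mod 1 be represented by a \<open>y\<close> in a fixed
  compact interval on which the first \<open>n\<close> factors are bounded below. Since \<open>D (e 0) = 1\<close>
  and \<open>ln D = O(x)\<close>, \<open>P\<close> is near \<open>1\<close> close to \<open>0\<close>, so \<open>Q (\<tau>\<^sup>n y)\<close> is near \<open>1\<close> for large
  \<open>n\<close>; this forces \<open>\<alpha> = 1\<close>.

  Given this, put \<open>R \<xi> = F \<cdot> (\<xi> \<circ> h)\<close> for a measurable \<open>F\<close> with \<open>|F|\<^sup>2 = P\<close>. Then \<open>R\<close> is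
  isometric, and it intertwines the two operators if \<open>F (\<Phi> x) = u (e x) F x\<close>. The
  modulus of this equation is the relation for \<open>P\<close>; its phase is solved because \<open>\<Phi>\<close> has
  a fundamental domain on the punctured line (\<open>unimodular_cocycle_trivial\<close>). Finally \<open>R\<close>
  is onto because \<open>F \<noteq> 0\<close> almost everywhere: surjectivity of \<open>U_tilde\<close> forces \<open>m \<noteq> 0\<close>
  almost everywhere, and a product of nonzero factors that converges to \<open>1\<close> fast enough
  is nonzero.
\<close>

section \<open>Weighted composition operators between spaces of square-integrable functions\<close>

lemma sq_integrable_measurable [measurable_dest]:
  "f \<in> sq_integrable M \<Longrightarrow> f \<in> borel_measurable M"
  by (simp add: sq_integrable_def)

lemma sq_integrable_iff_nn_integral:
  "f \<in> sq_integrable M \<longleftrightarrow>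
     f \<in> borel_measurable M \<and> (\<integral>\<^sup>+x. ennreal ((cmod (f x))\<^sup>2) \<partial>M) < \<infinity>"
  unfolding sq_integrable_def by (auto simp: integrable_iff_bounded)

lemma sq_integrable_scale:
  assumes "f \<in> sq_integrable M"
  shows "(\<lambda>x. c * f x) \<in> sq_integrable M"
  using assms by (auto simp: sq_integrable_def norm_mult power_mult_distrib)

lemma sq_integrable_add:
  assumes "f \<in> sq_integrable M" "g \<in> sq_integrable M"
  shows "(\<lambda>x. f x + g x) \<in> sq_integrable M"
proof -
  note [measurable] = assms[THEN sq_integrable_measurable]
  have "integrable M (\<lambda>x. 2 * (cmod (f x))\<^sup>2 + 2 * (cmod (g x))\<^sup>2)"
    using assms by (auto simp: sq_integrable_def)
  then have "integrable M (\<lambda>x. (cmod (f x + g x))\<^sup>2)"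
  proof (rule Bochner_Integration.integrable_bound, goal_cases)
    case 2
    have "(cmod (f x + g x))\<^sup>2 \<le> 2 * (cmod (f x))\<^sup>2 + 2 * (cmod (g x))\<^sup>2" for x
    proof -
      have "(cmod (f x + g x))\<^sup>2 \<le> (cmod (f x) + cmod (g x))\<^sup>2"
        by (intro power_mono norm_triangle_ineq) auto
      moreover have "(cmod (f x) + cmod (g x))\<^sup>2 + (cmod (f x) - cmod (g x))\<^sup>2
          = 2 * (cmod (f x))\<^sup>2 + 2 * (cmod (g x))\<^sup>2"
        by (simp add: power2_eq_square algebra_simps)
      ultimately show ?thesis
        using zero_le_power2[of "cmod (f x) - cmod (g x)"] by linarith
    qed
    then show ?case by simp
  qed simp
  then show ?thesis by (simp add: sq_integrable_def)
qed

lemma L2_class_iff: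
  "g \<in> L2_class M f \<longleftrightarrow> f \<in> sq_integrable M \<and> g \<in> sq_integrable M \<and> (AE x in M. f x = g x)"
  by (simp add: L2_class_def ae_eq_def)

lemma L2_class_cong:
  assumes "f \<in> sq_integrable M" "g \<in> sq_integrable M" "AE x in M. f x = g x"
  shows "L2_class M f = L2_class M g"
proof -
  have "h \<in> L2_class M f \<longleftrightarrow> h \<in> L2_class M g" for h
    unfolding L2_class_iff using assms by (auto elim!: eventually_elim2)
  then show ?thesis by blast
qed

lemma mem_L2_class: "f \<in> sq_integrable M \<Longrightarrow> f \<in> L2_class M f"
  by (simp add: L2_class_iff)

lemma L2_class_in_L2: "f \<in> sq_integrable M \<Longrightarrow> L2_class M f \<in> L2 M"
  unfolding L2_def L2_class_def by (rule quotientI)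

lemma L2_cases:
  assumes "A \<in> L2 M"
  obtains f where "f \<in> sq_integrable M" "A = L2_class M f"
  using assms unfolding L2_def L2_class_def by (auto elim!: quotientE)

text \<open>Every lifted operation is evaluated through this observation.\<close>

lemma UN_L2_class_const:
  assumes "f \<in> sq_integrable M" "\<And>g. g \<in> L2_class M f \<Longrightarrow> B g = C"
  shows "(\<Union>g\<in>L2_class M f. B g) = C"
  using assms(2) mem_L2_class[OF assms(1)] by auto

lemma L2_add_class:
  assumes "f \<in> sq_integrable M" "g \<in> sq_integrable M"
  shows "L2_add M (L2_class M f) (L2_class M g) = L2_class M (\<lambda>x. f x + g x)"
  unfolding L2_add_def
proof (intro UN_L2_class_const assms)
  fix f' g' assume "f' \<in> L2_class M f" "g' \<in> L2_class M g"
  then show "L2_class M (\<lambda>x. f' x + g' x) = L2_class M (\<lambda>x. f x + g x)"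
    unfolding L2_class_iff by (intro L2_class_cong sq_integrable_add) (auto elim!: eventually_elim2)
qed

lemma L2_scale_class:
  assumes "f \<in> sq_integrable M"
  shows "L2_scale M c (L2_class M f) = L2_class M (\<lambda>x. c * f x)"
  unfolding L2_scale_def
proof (intro UN_L2_class_const assms)
  fix f' assume "f' \<in> L2_class M f"
  then have f': "f' \<in> sq_integrable M" "AE x in M. f x = f' x"
    by (auto simp: L2_class_iff)
  from f'(2) have "AE x in M. c * f' x = c * f x"
    by eventually_elim simp
  then show "L2_class M (\<lambda>x. c * f' x) = L2_class M (\<lambda>x. c * f x)"
    using f' assms by (intro L2_class_cong sq_integrable_scale)
qed

lemma L2_norm_class:
  assumes "f \<in> sq_integrable M"
  shows "L2_norm M (L2_class M f) = sqrt (LINT x|M. (cmod (f x))\<^sup>2)"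
proof -
  have "sqrt (LINT x|M. (cmod (g x))\<^sup>2) = sqrt (LINT x|M. (cmod (f x))\<^sup>2)"
    if "g \<in> L2_class M f" for g
  proof -
    note [measurable] = assms[THEN sq_integrable_measurable]
    have [measurable]: "g \<in> borel_measurable M"
      using that by (simp add: L2_class_iff sq_integrable_def)
    show ?thesis
      using that by (intro arg_cong[where f = sqrt] integral_cong_AE) (auto simp: L2_class_iff)
  qed
  then have "(\<lambda>g. sqrt (LINT x|M. (cmod (g x))\<^sup>2)) ` L2_class M f
      = (\<lambda>_. sqrt (LINT x|M. (cmod (f x))\<^sup>2)) ` L2_class M f"
    by (rule image_cong[OF refl])
  also have "\<dots> = {sqrt (LINT x|M. (cmod (f x))\<^sup>2)}"
    by (rule image_constant[OF mem_L2_class[OF assms]])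
  finally show ?thesis by (simp add: L2_norm_def)
qed

text \<open>
  Both operators of the theorem and the isomorphism \<open>R\<close> have the form \<open>\<xi> \<mapsto> w \<cdot> (\<xi> \<circ> T)\<close>. As for
  the other lifted operations, the class is obtained as a union over representatives.
\<close>

definition comp_op ::
  "'b measure \<Rightarrow> ('b \<Rightarrow> complex) \<Rightarrow> ('b \<Rightarrow> 'a) \<Rightarrow> ('a \<Rightarrow> complex) set \<Rightarrow> ('b \<Rightarrow> complex) set" where
  "comp_op M' w T A = (\<Union>\<xi>\<in>A. L2_class M' (\<lambda>x. w x * \<xi> (T x)))"

text \<open>
  The change-of-variables condition under which \<open>\<xi> \<mapsto> w \<cdot> (\<xi> \<circ> T)\<close> preserves \<open>L\<^sup>2\<close> norms. It is
  stated on measures because this also yields that the operator respects null sets.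
\<close>

definition transports ::
  "'a measure \<Rightarrow> 'b measure \<Rightarrow> ('b \<Rightarrow> complex) \<Rightarrow> ('b \<Rightarrow> 'a) \<Rightarrow> bool" where
  "transports M M' w T \<longleftrightarrow>
     w \<in> borel_measurable M' \<and> T \<in> M' \<rightarrow>\<^sub>M M \<and>
     distr (density M' (\<lambda>x. ennreal ((cmod (w x))\<^sup>2))) M T = M"

lemma transports_nn_integral:
  assumes "transports M M' w T" and [measurable]: "g \<in> borel_measurable M"
  shows "(\<integral>\<^sup>+x. g x \<partial>M) = (\<integral>\<^sup>+x. ennreal ((cmod (w x))\<^sup>2) * g (T x) \<partial>M')"
proof -
  have [measurable]: "w \<in> borel_measurable M'" "T \<in> M' \<rightarrow>\<^sub>M M"
    using assms by (auto simp: transports_def)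
  have "(\<integral>\<^sup>+x. g x \<partial>M) =
      (\<integral>\<^sup>+x. g x \<partial>distr (density M' (\<lambda>x. ennreal ((cmod (w x))\<^sup>2))) M T)"
    using assms by (simp add: transports_def)
  also have "\<dots> = (\<integral>\<^sup>+x. ennreal ((cmod (w x))\<^sup>2) * g (T x) \<partial>M')"
    by (simp add: nn_integral_distr nn_integral_density)
  finally show ?thesis .
qed

lemma transportsI:
  assumes [measurable]: "w \<in> borel_measurable M'" "T \<in> M' \<rightarrow>\<^sub>M M"
    and "\<And>A. A \<in> sets M \<Longrightarrow>
      emeasure M A = (\<integral>\<^sup>+x. ennreal ((cmod (w x))\<^sup>2) * indicator A (T x) \<partial>M')"
  shows "transports M M' w T"
  unfolding transports_def
proof (intro conjI measure_eqI)
  fix A assume "A \<in> sets (distr (density M' (\<lambda>x. ennreal ((cmod (w x))\<^sup>2))) M T)"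
  then have [measurable]: "A \<in> sets M" by simp
  have "emeasure (distr (density M' (\<lambda>x. ennreal ((cmod (w x))\<^sup>2))) M T) A =
      (\<integral>\<^sup>+y. indicator A y \<partial>distr (density M' (\<lambda>x. ennreal ((cmod (w x))\<^sup>2))) M T)"
    by simp
  also have "\<dots> = (\<integral>\<^sup>+x. ennreal ((cmod (w x))\<^sup>2) * indicator A (T x) \<partial>M')"
    by (subst nn_integral_distr) (simp_all add: nn_integral_density)
  finally show "emeasure (distr (density M' (\<lambda>x. ennreal ((cmod (w x))\<^sup>2))) M T) A = emeasure M A"
    using assms(3) by simp
qed (use assms in auto)

lemma transports_sq_norm:
  assumes "transports M M' w T" "\<xi> \<in> borel_measurable M"
  shows "(\<integral>\<^sup>+x. ennreal ((cmod (w x * \<xi> (T x)))\<^sup>2) \<partial>M') = (\<integral>\<^sup>+x. ennreal ((cmod (\<xi> x))\<^sup>2) \<partial>M)"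
proof -
  note [measurable] = assms(2)
  show ?thesis
    by (subst transports_nn_integral[OF assms(1)])
       (auto simp: norm_mult power_mult_distrib ennreal_mult)
qed

text \<open>
  A null set \<open>N\<close> of \<open>M\<close> has \<open>|w|\<^sup>2\<close>-weighted preimage of measure zero, so \<open>T\<close> can only meet
  \<open>N\<close> where the weight vanishes. This makes the operator well defined on classes.
\<close>

lemma transports_AE:
  assumes "transports M M' w T" "AE x in M. Q x"
  shows "AE x in M'. w x \<noteq> 0 \<longrightarrow> Q (T x)"
proof -
  have [measurable]: "w \<in> borel_measurable M'" "T \<in> M' \<rightarrow>\<^sub>M M"
    using assms by (auto simp: transports_def)
  obtain N where N: "N \<in> null_sets M" "{x\<in>space M. \<not> Q x} \<subseteq> N"
    using assms(2) by (auto simp: eventually_ae_filter)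
  have [measurable]: "N \<in> sets M" using N by auto
  have "0 = (\<integral>\<^sup>+x. indicator N x \<partial>M)" using N by auto
  also have "\<dots> = (\<integral>\<^sup>+x. ennreal ((cmod (w x))\<^sup>2) * indicator N (T x) \<partial>M')"
    by (rule transports_nn_integral[OF assms(1)]) measurable
  finally have "AE x in M'. ennreal ((cmod (w x))\<^sup>2) * indicator N (T x) = 0"
    by (simp add: nn_integral_0_iff_AE)
  moreover have "AE x in M'. T x \<in> space M"
    using measurable_space[of T M' M] by auto
  ultimately show ?thesis
    by eventually_elim (use N in \<open>auto simp: indicator_def split: if_splits\<close>)
qed

text \<open>
  The measure of the exceptional set is a weighted integral over its preimage, which is null.
\<close>

lemma transports_AE_converse:
  assumes "transports M M' w T" and [measurable]: "Measurable.pred M Q"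
    and "AE x in M'. Q (T x)"
  shows "AE y in M. Q y"
proof -
  have [measurable]: "w \<in> borel_measurable M'" "T \<in> M' \<rightarrow>\<^sub>M M"
    using assms by (auto simp: transports_def)
  have [measurable]: "{y \<in> space M. \<not> Q y} \<in> sets M" by measurable
  have "emeasure M {y \<in> space M. \<not> Q y}
      = (\<integral>\<^sup>+x. ennreal ((cmod (w x))\<^sup>2) * indicator {y \<in> space M. \<not> Q y} (T x) \<partial>M')"
    by (subst transports_nn_integral[OF assms(1), symmetric]) simp_all
  also have "\<dots> = (\<integral>\<^sup>+x. 0 \<partial>M')"
    using assms(3) by (intro nn_integral_cong_AE) (auto elim!: eventually_mono)
  finally show ?thesis
    by (intro AE_I[OF subset_refl]) simp_all
qed

lemma transports_sq_integrable:
  assumes "transports M M' w T" "\<xi> \<in> sq_integrable M"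
  shows "(\<lambda>x. w x * \<xi> (T x)) \<in> sq_integrable M'"
proof -
  have [measurable]: "w \<in> borel_measurable M'" "T \<in> M' \<rightarrow>\<^sub>M M" "\<xi> \<in> borel_measurable M"
    using assms by (auto simp: transports_def sq_integrable_def)
  show ?thesis
    using assms(2) unfolding sq_integrable_iff_nn_integral
    by (auto simp: transports_sq_norm[OF assms(1)])
qed

lemma comp_op_class:
  assumes "transports M M' w T" "\<xi> \<in> sq_integrable M"
  shows "comp_op M' w T (L2_class M \<xi>) = L2_class M' (\<lambda>x. w x * \<xi> (T x))"
  unfolding comp_op_def
proof (intro UN_L2_class_const assms)
  fix \<eta> assume \<eta>: "\<eta> \<in> L2_class M \<xi>"
  then have "AE x in M'. w x \<noteq> 0 \<longrightarrow> \<xi> (T x) = \<eta> (T x)"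
    by (intro transports_AE[OF assms(1)]) (auto simp: L2_class_iff)
  then show "L2_class M' (\<lambda>x. w x * \<eta> (T x)) = L2_class M' (\<lambda>x. w x * \<xi> (T x))"
    using \<eta> by (intro L2_class_cong transports_sq_integrable[OF assms(1)])
      (auto simp: L2_class_iff elim!: eventually_mono)
qed

text \<open>
  Surjectivity: a preimage of \<open>g\<close> is \<open>(g / w) \<circ> k\<close>, which needs a measurable left inverse \<open>k\<close> of
  \<open>T\<close> and a weight that is nonzero almost everywhere.
\<close>

lemma comp_op_isometric_iso:
  assumes tr: "transports M M' w T"
    and nz: "AE x in M'. w x \<noteq> 0"
    and k [measurable]: "k \<in> M \<rightarrow>\<^sub>M M'" and kT: "\<And>x. x \<in> space M' \<Longrightarrow> k (T x) = x"
  shows "L2_isometric_iso M M' (comp_op M' w T)"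
  unfolding L2_isometric_iso_def
proof (intro conjI ballI allI)
  have [measurable]: "w \<in> borel_measurable M'" "T \<in> M' \<rightarrow>\<^sub>M M"
    using tr by (auto simp: transports_def)
  note cls = comp_op_class[OF tr] and sq = transports_sq_integrable[OF tr]
  show "bij_betw (comp_op M' w T) (L2 M) (L2 M')"
  proof (rule bij_betwI')
    fix A B assume AB: "A \<in> L2 M" "B \<in> L2 M"
    have "A = B" if eq: "comp_op M' w T A = comp_op M' w T B"
    proof -
      obtain f where f: "f \<in> sq_integrable M" "A = L2_class M f" using AB by (auto elim: L2_cases)
      obtain g where g: "g \<in> sq_integrable M" "B = L2_class M g" using AB by (auto elim: L2_cases)
      note [measurable] = f(1)[THEN sq_integrable_measurable] g(1)[THEN sq_integrable_measurable]
      have "(\<lambda>x. w x * g (T x)) \<in> L2_class M' (\<lambda>x. w x * f (T x))"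
        using eq mem_L2_class[OF sq[OF g(1)]] f g by (simp add: cls)
      then have "AE x in M'. w x * f (T x) = w x * g (T x)"
        by (simp add: L2_class_iff)
      with nz have eq: "AE x in M'. f (T x) = g (T x)"
        by eventually_elim simp
      have "AE x in M. f x = g x"
        by (rule transports_AE_converse[OF tr _ eq]) measurable
      then show ?thesis
        unfolding f(2) g(2) by (rule L2_class_cong[OF f(1) g(1)])
    qed
    then show "comp_op M' w T A = comp_op M' w T B \<longleftrightarrow> A = B" by blast
  next
    fix A assume "A \<in> L2 M"
    then show "comp_op M' w T A \<in> L2 M'"
      by (auto elim!: L2_cases simp: cls intro!: L2_class_in_L2 sq)
  next
    fix B assume "B \<in> L2 M'"
    then obtain g where g: "g \<in> sq_integrable M'" "B = L2_class M' g" by (auto elim: L2_cases)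
    note [measurable] = g(1)[THEN sq_integrable_measurable]
    define f where "f = (\<lambda>y. g (k y) / w (k y))"
    have [measurable]: "f \<in> borel_measurable M" unfolding f_def by measurable
    have eq: "AE x in M'. w x * f (T x) = g x"
      using nz AE_space by eventually_elim (simp add: f_def kT)
    have "(\<integral>\<^sup>+x. ennreal ((cmod (f x))\<^sup>2) \<partial>M) = (\<integral>\<^sup>+x. ennreal ((cmod (w x * f (T x)))\<^sup>2) \<partial>M')"
      by (simp add: transports_sq_norm[OF tr])
    also have "\<dots> = (\<integral>\<^sup>+x. ennreal ((cmod (g x))\<^sup>2) \<partial>M')"
      by (intro nn_integral_cong_AE) (use eq in \<open>auto elim!: eventually_mono\<close>)
    finally have f: "f \<in> sq_integrable M"
      using g by (auto simp: sq_integrable_iff_nn_integral)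
    have "comp_op M' w T (L2_class M f) = B"
      unfolding cls[OF f] g(2) by (rule L2_class_cong[OF sq[OF f] g(1) eq])
    then show "\<exists>A\<in>L2 M. B = comp_op M' w T A"
      using L2_class_in_L2[OF f] by blast
  qed
  fix A assume "A \<in> L2 M"
  then obtain f where f: "f \<in> sq_integrable M" "A = L2_class M f" by (auto elim: L2_cases)
  note [measurable] = f(1)[THEN sq_integrable_measurable]
  show "comp_op M' w T (L2_add M A B) = L2_add M' (comp_op M' w T A) (comp_op M' w T B)"
    if "B \<in> L2 M" for B
  proof -
    obtain g where "g \<in> sq_integrable M" "B = L2_class M g" using \<open>B \<in> L2 M\<close> by (auto elim: L2_cases)
    then show ?thesis
      using f by (simp add: cls sq L2_add_class sq_integrable_add distrib_left)
  qed
  show "comp_op M' w T (L2_scale M c A) = L2_scale M' c (comp_op M' w T A)" for c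
    by (simp only: f(2) L2_scale_class[OF f(1)] L2_scale_class[OF sq[OF f(1)]]
        cls[OF f(1)] cls[OF sq_integrable_scale[OF f(1)]] mult.left_commute)
  have "(LINT x|M'. (cmod (w x * f (T x)))\<^sup>2) = (LINT x|M. (cmod (f x))\<^sup>2)"
    by (subst (1 2) integral_eq_nn_integral) (auto simp: transports_sq_norm[OF tr])
  then show "L2_norm M' (comp_op M' w T A) = L2_norm M A"
    using f by (simp add: cls sq L2_norm_class)
qed

lemma comp_op_intertwine:
  assumes "transports M M w T" "transports M M' v S" "transports M' M' w' T'"
    and "AE x in M'. v x * w (S x) = w' x * v (T' x)"
    and "\<And>x. x \<in> space M' \<Longrightarrow> T (S x) = S (T' x)"
    and "A \<in> L2 M"
  shows "comp_op M' v S (comp_op M w T A) = comp_op M' w' T' (comp_op M' v S A)"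
proof -
  obtain f where f: "f \<in> sq_integrable M" "A = L2_class M f" using assms(6) by (auto elim: L2_cases)
  note sq = transports_sq_integrable
  have "comp_op M' v S (comp_op M w T A) = L2_class M' (\<lambda>x. v x * (w (S x) * f (T (S x))))"
    using f by (simp add: comp_op_class[OF assms(1)] comp_op_class[OF assms(2)] sq[OF assms(1)])
  also have "\<dots> = L2_class M' (\<lambda>x. w' x * (v (T' x) * f (S (T' x))))"
  proof (rule L2_class_cong)
    show "AE x in M'. v x * (w (S x) * f (T (S x))) = w' x * (v (T' x) * f (S (T' x)))"
      using assms(4) AE_space
    proof eventually_elim
      case (elim x)
      then show ?case using assms(5)[of x] by (simp add: mult.assoc[symmetric])
    qed
  qed (use f in \<open>auto intro!: sq[OF assms(2)] sq[OF assms(1)] sq[OF assms(3)]\<close>)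
  also have "\<dots> = comp_op M' w' T' (comp_op M' v S A)"
    using f by (simp add: comp_op_class[OF assms(3)] comp_op_class[OF assms(2)] sq[OF assms(2)])
  finally show ?thesis .
qed

text \<open>
  Every function in the range vanishes where \<open>w\<close> does, and on a probability space the constant
  \<open>1\<close> is one of the functions to be reached.
\<close>

lemma comp_op_surj_nonzero:
  assumes "prob_space M" "comp_op M w T ` L2 M = L2 M"
  shows "AE x in M. w x \<noteq> 0"
proof -
  interpret prob_space M by fact
  have one: "(\<lambda>_. 1) \<in> sq_integrable M" by (simp add: sq_integrable_def)
  then obtain A where A: "comp_op M w T A = L2_class M (\<lambda>_. 1)"
    using L2_class_in_L2[OF one] assms(2) by (metis imageE)
  then have "(\<lambda>_. 1) \<in> comp_op M w T A" using mem_L2_class[OF one] by simp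
  then obtain \<xi> where "AE x in M. w x * \<xi> (T x) = 1"
    by (auto simp: comp_op_def L2_class_iff)
  then show ?thesis by eventually_elim auto
qed

section \<open>The lift of an expanding circle map to the line\<close>

abbreviation turn :: "real \<Rightarrow> complex" where
  "turn x \<equiv> cis (2 * pi * x)"

definition angle :: "complex \<Rightarrow> real" where
  "angle z = Arg z / (2 * pi)"

lemma turn_in_circle: "turn x \<in> circle"
  by simp

lemma turn_angle: "z \<in> circle \<Longrightarrow> turn (angle z) = z"
  using cis_Arg[of z] by (cases "z = 0") (auto simp: angle_def sgn_div_norm)

lemma turn_add_int [simp]: "turn (x + of_int k) = turn x"
proof -
  have "turn (x + of_int k) = turn x * cis (2 * pi * of_int k)"
    by (simp add: distrib_left cis_mult[symmetric])
  then show ?thesis by (simp add: cis_multiple_2pi)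
qed

lemma turn_eq_iff: "turn x = turn y \<longleftrightarrow> (\<exists>k::int. y = x + of_int k)"
proof
  assume "turn x = turn y"
  then have "turn (y - x) = 1"
    by (simp add: right_diff_distrib cis_divide[symmetric])
  then have "cos (2 * pi * (y - x)) = 1"
    by (metis cis.sel(1) one_complex.sel(1))
  then obtain k :: int where "2 * pi * (y - x) = of_int k * 2 * pi"
    by (auto simp: cos_one_2pi_int)
  then have "(2 * pi) * (y - x) = (2 * pi) * of_int k" by (simp only: mult_ac)
  then have "y = x + of_int k" by simp
  then show "\<exists>k::int. y = x + of_int k" ..
qed (auto simp del: turn_add_int intro: turn_add_int[symmetric])

lemma angle_turn:
  assumes "\<bar>x\<bar> < 1 / 2"
  shows "angle (turn x) = x"
proof -
  have "Arg (turn x) = 2 * pi * x"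
  proof (rule cis_Arg_unique)
    have "- pi < pi * (2 * x) \<and> pi * (2 * x) < pi * 1"
      using assms mult_strict_left_mono[of "-1" "2 * x" pi] mult_strict_left_mono[of "2 * x" 1 pi]
      by (auto simp: abs_less_iff)
    then show "- pi < 2 * pi * x" "2 * pi * x \<le> pi" by (simp_all add: mult_ac)
  qed simp
  then show ?thesis by (simp add: angle_def)
qed

lemma continuous_on_turn: "continuous_on UNIV turn"
  by (intro continuous_intros)

lemma measurable_turn [measurable]: "turn \<in> borel_measurable borel"
  by (intro borel_measurable_continuous_onI continuous_on_turn)

text \<open>
  \<open>Arg\<close> is continuous off the closed negative real axis and constant on the punctured axis.
\<close>

lemma measurable_angle [measurable]: "angle \<in> borel_measurable borel"
proof -
  let ?f = "\<lambda>z. indicator (- \<real>\<^sub>\<le>\<^sub>0) z *\<^sub>R Arg z"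
  let ?g = "\<lambda>z::complex. if z \<in> \<real>\<^sub>\<le>\<^sub>0 - {0} then pi else 0"
  have [measurable]: "\<real>\<^sub>\<le>\<^sub>0 - {0 :: complex} \<in> sets borel" by auto
  have "?f \<in> borel_measurable borel"
    by (intro borel_measurable_continuous_on_indicator continuous_on_Arg) auto
  moreover have "?g \<in> borel_measurable borel" by measurable
  ultimately have "(\<lambda>z. ?f z + ?g z) \<in> borel_measurable borel"
    by (rule borel_measurable_add)
  also have "(\<lambda>z. ?f z + ?g z) = Arg"
    by (rule ext) (auto elim!: nonpos_Reals_cases simp: Arg_of_real Arg_def[of 0])
  finally have [measurable]: "Arg \<in> borel_measurable borel" .
  show ?thesis unfolding angle_def[abs_def] by measurable
qed

text \<open>
  The lift data, separated from the weight: \<open>\<Phi> = primitive \<phi>\<close> is the lift of \<open>\<sigma>\<close>, and \<open>N\<close> its degree.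
\<close>

locale expanding_lift =
  fixes \<phi> :: "real \<Rightarrow> real" and N :: nat
  assumes cont: "continuous_on UNIV \<phi>"
    and periodic: "\<And>x. \<phi> (x + 1) = \<phi> x"
    and total: "primitive \<phi> 1 = real N"
    and gt_1: "\<And>x. \<phi> x > 1"
begin

abbreviation "\<Phi> \<equiv> primitive \<phi>"

definition \<tau> :: "real \<Rightarrow> real" where "\<tau> = inv \<Phi>"

lemma periodic_int: "\<phi> (x + of_int k) = \<phi> x"
proof (induction k arbitrary: x rule: int_induct[where k = 0])
  case (step1 i)
  then show ?case using periodic[of "x + of_int i"] by (simp add: add.assoc)
next
  case (step2 i)
  then show ?case using periodic[of "x + of_int i - 1"] by (simp add: algebra_simps)
qed simp

lemma phi_measurable [measurable]: "\<phi> \<in> borel_measurable borel"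
  by (intro borel_measurable_continuous_onI cont)

text \<open>
  A continuous periodic function attains its infimum, so \<open>\<phi> > 1\<close> improves to a uniform bound, and
  \<open>\<tau>\<close> becomes a strict contraction.
\<close>

lemma uniform_expansion: "\<exists>c>1. \<forall>x. c \<le> \<phi> x"
proof -
  have "continuous_on {0..1} \<phi>" using cont continuous_on_subset by blast
  then obtain t where t: "\<And>x. x \<in> {0..1} \<Longrightarrow> \<phi> t \<le> \<phi> x"
    using continuous_attains_inf[of "{0..1::real}" \<phi>] by fastforce
  have "\<phi> t \<le> \<phi> x" for x
  proof -
    have "\<phi> t \<le> \<phi> (frac x)"
      using frac_lt_1[of x] by (intro t) auto
    then show ?thesis
      using periodic_int[of "frac x" "\<lfloor>x\<rfloor>"] by (simp add: frac_def)
  qed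
  then show ?thesis using gt_1[of t] by blast
qed

lemma deriv: "(\<Phi> has_real_derivative \<phi> x) (at x)"
proof -
  define a where "a = min 0 x - 1"
  define b where "b = max 0 x + 1"
  have ab: "a \<le> 0" "0 \<le> b" "a < x" "x < b" by (auto simp: a_def b_def)
  have "((\<lambda>u. LBINT y=ereal 0..ereal u. \<phi> y) has_vector_derivative \<phi> x) (at x within {a..b})"
    using ab by (intro interval_integral_FTC2 continuous_on_subset[OF cont]) auto
  then have "(\<Phi> has_vector_derivative \<phi> x) (at x within {a..b})"
    by (simp add: primitive_def[abs_def])
  moreover have "at x within {a..b} = at x"
    using ab by (intro at_within_interior) auto
  ultimately show ?thesis
    by (simp add: has_real_derivative_iff_has_vector_derivative)
qed

lemma Phi_0 [simp]: "\<Phi> 0 = 0"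
  by (simp add: primitive_def interval_integral_endpoints_same)

lemma Phi_continuous: "continuous_on A \<Phi>"
  using DERIV_continuous_on[OF has_field_derivative_at_within[OF deriv]] by blast

lemma Phi_measurable [measurable]: "\<Phi> \<in> borel_measurable borel"
  by (intro borel_measurable_continuous_onI Phi_continuous)

lemma Phi_expands_ordered: "\<exists>c>1. \<forall>x y. x \<le> y \<longrightarrow> c * (y - x) \<le> \<Phi> y - \<Phi> x"
proof -
  obtain c where c: "c > 1" "\<And>x. c \<le> \<phi> x" using uniform_expansion by blast
  have "c * (y - x) \<le> \<Phi> y - \<Phi> x" if "x \<le> y" for x y
  proof (cases "x = y")
    case False
    with that have "x < y" by simp
    then obtain z where "\<Phi> y - \<Phi> x = (y - x) * \<phi> z"
      using MVT2[of x y \<Phi> \<phi>] deriv by blast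
    then show ?thesis using c(2)[of z] \<open>x < y\<close> by (simp add: mult.commute mult_left_mono)
  qed simp
  then show ?thesis using c by blast
qed

lemma Phi_strict_mono: "strict_mono \<Phi>"
proof -
  obtain c where c: "c > 1" "\<And>x y. x \<le> y \<Longrightarrow> c * (y - x) \<le> \<Phi> y - \<Phi> x"
    using Phi_expands_ordered by blast
  show ?thesis
  proof (rule strict_monoI)
    fix x y :: real assume "x < y"
    then have "0 < c * (y - x)" using c(1) by simp
    then show "\<Phi> x < \<Phi> y" using c(2)[of x y] \<open>x < y\<close> by linarith
  qed
qed

lemma Phi_surj: "surj \<Phi>"
proof -
  obtain c where c: "c > 1" "\<And>x y. x \<le> y \<Longrightarrow> c * (y - x) \<le> \<Phi> y - \<Phi> x"
    using Phi_expands_ordered by blast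
  have "\<exists>x. \<Phi> x = y" for y
  proof -
    have "1 * \<bar>y\<bar> \<le> c * \<bar>y\<bar>" using c(1) by (intro mult_right_mono) auto
    then have "\<Phi> (- \<bar>y\<bar>) \<le> y" "y \<le> \<Phi> \<bar>y\<bar>"
      using c(2)[of 0 "\<bar>y\<bar>"] c(2)[of "- \<bar>y\<bar>" 0] by auto
    then obtain x where "- \<bar>y\<bar> \<le> x" "x \<le> \<bar>y\<bar>" "\<Phi> x = y"
      using IVT'[of \<Phi> "- \<bar>y\<bar>" y "\<bar>y\<bar>"] Phi_continuous by auto
    then show ?thesis by blast
  qed
  then show ?thesis unfolding surj_def by metis
qed

lemma tau_Phi [simp]: "\<tau> (\<Phi> x) = x"
  unfolding \<tau>_def using strict_mono_imp_inj_on[OF Phi_strict_mono] by simp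

lemma Phi_tau [simp]: "\<Phi> (\<tau> x) = x"
  unfolding \<tau>_def using Phi_surj by (simp add: surj_f_inv_f)

lemma Phi_less_iff [simp]: "\<Phi> x < \<Phi> y \<longleftrightarrow> x < y"
  using strict_mono_less[OF Phi_strict_mono] .

lemma Phi_eq_iff [simp]: "\<Phi> x = \<Phi> y \<longleftrightarrow> x = y"
  using strict_mono_eq[OF Phi_strict_mono] .

lemma tau_less_iff [simp]: "\<tau> x < \<tau> y \<longleftrightarrow> x < y"
  using Phi_less_iff[of "\<tau> x" "\<tau> y"] by simp

lemma tau_le_iff [simp]: "\<tau> x \<le> \<tau> y \<longleftrightarrow> x \<le> y"
  by (simp flip: not_less)

lemma tau_0 [simp]: "\<tau> 0 = 0"
  using tau_Phi[of 0] by simp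

lemma tau_contracts: "\<exists>q. 0 < q \<and> q < 1 \<and> (\<forall>x y. \<bar>\<tau> x - \<tau> y\<bar> \<le> q * \<bar>x - y\<bar>)"
proof -
  obtain c where c: "c > 1" "\<And>x y. x \<le> y \<Longrightarrow> c * (y - x) \<le> \<Phi> y - \<Phi> x"
    using Phi_expands_ordered by blast
  have "\<bar>\<tau> x - \<tau> y\<bar> \<le> inverse c * \<bar>x - y\<bar>" for x y
  proof (cases "x \<le> y")
    case True
    then show ?thesis using c(2)[of "\<tau> x" "\<tau> y"] c(1) by (simp add: field_simps)
  next
    case False
    then show ?thesis using c(2)[of "\<tau> y" "\<tau> x"] c(1) by (simp add: field_simps)
  qed
  then show ?thesis using c(1) by (intro exI[of _ "inverse c"]) (auto simp: field_simps)
qed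

lemma tau_iter_contracts:
  "\<exists>q. 0 < q \<and> q < 1 \<and> (\<forall>n x. \<bar>(\<tau> ^^ n) x\<bar> \<le> q ^ n * \<bar>x\<bar>)"
proof -
  obtain q where q: "0 < q" "q < 1" "\<And>x y. \<bar>\<tau> x - \<tau> y\<bar> \<le> q * \<bar>x - y\<bar>"
    using tau_contracts by blast
  have "\<bar>(\<tau> ^^ n) x\<bar> \<le> q ^ n * \<bar>x\<bar>" for n x
  proof (induction n)
    case (Suc n)
    have "\<bar>(\<tau> ^^ Suc n) x\<bar> \<le> q * \<bar>(\<tau> ^^ n) x\<bar>"
      using q(3)[of "(\<tau> ^^ n) x" 0] by simp
    also have "\<dots> \<le> q * (q ^ n * \<bar>x\<bar>)"
      using Suc q(1) by (intro mult_left_mono) auto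
    finally show ?case by simp
  qed simp
  then show ?thesis using q by blast
qed

lemma tau_iter_tendsto_0: "(\<lambda>n. (\<tau> ^^ n) x) \<longlonglongrightarrow> 0"
proof -
  obtain q where q: "0 < q" "q < 1" "\<And>n x. \<bar>(\<tau> ^^ n) x\<bar> \<le> q ^ n * \<bar>x\<bar>"
    using tau_iter_contracts by blast
  show ?thesis
  proof (rule Lim_null_comparison)
    show "\<forall>\<^sub>F n in sequentially. norm ((\<tau> ^^ n) x) \<le> q ^ n * \<bar>x\<bar>"
      using q(3) by (intro always_eventually allI) simp
    show "(\<lambda>n. q ^ n * \<bar>x\<bar>) \<longlonglongrightarrow> 0"
      using q by (intro tendsto_mult_left_zero LIMSEQ_power_zero) simp
  qed
qed

lemma tau_iter_Phi_iter [simp]: "(\<tau> ^^ n) ((\<Phi> ^^ n) x) = x"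
proof (induction n)
  case (Suc n)
  have "(\<tau> ^^ Suc n) ((\<Phi> ^^ Suc n) x) = (\<tau> ^^ n) (\<tau> (\<Phi> ((\<Phi> ^^ n) x)))"
    by (simp only: funpow_Suc_right[of n \<tau>] funpow.simps(2)[of n \<Phi>] o_apply)
  then show ?case using Suc by simp
qed simp

lemma Phi_iter_tau_iter [simp]: "(\<Phi> ^^ n) ((\<tau> ^^ n) x) = x"
proof (induction n)
  case (Suc n)
  have "(\<Phi> ^^ Suc n) ((\<tau> ^^ Suc n) x) = (\<Phi> ^^ n) (\<Phi> (\<tau> ((\<tau> ^^ n) x)))"
    by (simp only: funpow_Suc_right[of n \<Phi>] funpow.simps(2)[of n \<tau>] o_apply)
  then show ?case using Suc by simp
qed simp

lemma tau_continuous: "continuous_on UNIV \<tau>"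
proof -
  obtain q where q: "0 < q" "\<And>x y. \<bar>\<tau> x - \<tau> y\<bar> \<le> q * \<bar>x - y\<bar>"
    using tau_contracts by blast
  have "q-lipschitz_on UNIV \<tau>"
    using q by (intro lipschitz_onI) (auto simp: dist_real_def)
  then show ?thesis by (rule lipschitz_on_continuous_on)
qed

lemma tau_measurable [measurable]: "\<tau> \<in> borel_measurable borel"
  by (intro borel_measurable_continuous_onI tau_continuous)

lemma tau_iter_measurable [measurable]: "(\<tau> ^^ n) \<in> borel_measurable borel"
proof (induction n)
  case (Suc n)
  then show ?case using measurable_compose[OF Suc tau_measurable] by (simp add: comp_def)
qed (simp add: id_def)

lemma Phi_iter_measurable [measurable]: "(\<Phi> ^^ n) \<in> borel_measurable borel"
proof (induction n)
  case (Suc n)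
  then show ?case using measurable_compose[OF Suc Phi_measurable] by (simp add: comp_def)
qed (simp add: id_def)

lemma Phi_add_1: "\<Phi> (x + 1) = \<Phi> x + real N"
proof -
  have "((\<lambda>x. \<Phi> (x + 1) - \<Phi> x) has_real_derivative 0) (at x)" for x
  proof -
    have "((\<lambda>x. \<Phi> (x + 1)) has_real_derivative \<phi> (x + 1)) (at x)"
      using deriv[of "x + 1"] by (simp add: DERIV_shift)
    from DERIV_diff[OF this deriv[of x]] show ?thesis by (simp add: periodic)
  qed
  then have "\<Phi> (x + 1) - \<Phi> x = \<Phi> (0 + 1) - \<Phi> 0"
    using DERIV_isconst_all by blast
  then show ?thesis using total by simp
qed

lemma Phi_add_int: "\<Phi> (x + of_int k) = \<Phi> x + of_int (k * int N)"
proof (induction k arbitrary: x rule: int_induct[where k = 0])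
  case (step1 i)
  then show ?case using Phi_add_1[of "x + of_int i"] by (simp add: algebra_simps)
next
  case (step2 i)
  then show ?case using Phi_add_1[of "x + of_int i - 1"] by (simp add: algebra_simps)
qed simp

lemma tau_add_int: "\<tau> (x + of_int (k * int N)) = \<tau> x + of_int k"
  using Phi_add_int[of "\<tau> x" k] tau_Phi[of "\<tau> x + of_int k"] by simp

text \<open>
  Substitution \<open>y = \<Phi> x\<close>, checked on intervals by the fundamental theorem of calculus.
\<close>

lemma transports_Phi:
  "transports lborel lborel (\<lambda>x. complex_of_real (sqrt (\<phi> x))) \<Phi>"
proof -
  have pos: "\<phi> x > 0" for x using gt_1[of x] by linarith
  have "lborel = distr (density lborel (\<lambda>x. ennreal (\<phi> x))) lborel \<Phi>"
  proof (rule lborel_eqI)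
    fix l u :: real assume "\<And>b. b \<in> Basis \<Longrightarrow> l \<bullet> b \<le> u \<bullet> b"
    then have lu: "l \<le> u" by simp
    have vim: "\<Phi> -` {l<..<u} = {\<tau> l<..<\<tau> u}"
      using Phi_less_iff[of "\<tau> l"] Phi_less_iff[of _ "\<tau> u"] by auto
    have "emeasure (distr (density lborel (\<lambda>x. ennreal (\<phi> x))) lborel \<Phi>) {l<..<u}
        = (\<integral>\<^sup>+x. ennreal (\<phi> x) * indicator {\<tau> l<..<\<tau> u} x \<partial>lborel)"
      by (simp add: emeasure_distr emeasure_density vim)
    also have "\<dots> = (\<integral>\<^sup>+x. ennreal (\<phi> x) * indicator {\<tau> l..\<tau> u} x \<partial>lborel)"
    proof (intro nn_integral_cong_AE)
      have "AE x in lborel. x \<noteq> \<tau> l" "AE x in lborel. x \<noteq> \<tau> u"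
        by (rule AE_lborel_singleton)+
      then show "AE x in lborel. ennreal (\<phi> x) * indicator {\<tau> l<..<\<tau> u} x
          = ennreal (\<phi> x) * indicator {\<tau> l..\<tau> u} x"
        by eventually_elim (auto simp: indicator_def)
    qed
    also have "\<dots> = ennreal (\<Phi> (\<tau> u) - \<Phi> (\<tau> l))"
      using lu pos by (intro nn_integral_FTC_Icc has_field_derivative_at_within[OF deriv])
        (auto intro: less_imp_le)
    finally show "emeasure (distr (density lborel (\<lambda>x. ennreal (\<phi> x))) lborel \<Phi>) (box l u)
        = (\<Prod>b\<in>Basis. (u - l) \<bullet> b)"
      by simp
  qed simp
  then show ?thesis
    unfolding transports_def using pos by (simp add: less_imp_le)
qed

end

section \<open>Path measures evaluated on cylinders and points\<close>

lemma measurable_coordinate [measurable]: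
  "(\<lambda>\<zeta>::nat \<Rightarrow> complex. \<zeta> n) \<in> borel_measurable (restrict_space borel S)"
  by (intro measurable_restrict_space1 borel_measurable_continuous_onI
      continuous_on_product_coordinates)

text \<open>
  On sequences in \<open>\<complex>\<close> the Borel algebra of the product topology is the product \<open>\<sigma>\<close>-algebra, so
  measurability is a matter of coordinates.
\<close>

lemma measurable_into_solenoid:
  assumes "\<And>n. (\<lambda>x. g x n) \<in> borel_measurable M" and "\<And>x. x \<in> space M \<Longrightarrow> g x \<in> solenoid \<sigma>"
  shows "g \<in> M \<rightarrow>\<^sub>M restrict_space borel (solenoid \<sigma>)"
proof (rule measurable_restrict_space2)
  have "g \<in> M \<rightarrow>\<^sub>M Pi\<^sub>M UNIV (\<lambda>i::nat. borel)"
    using measurable_PiM_single'[of UNIV "\<lambda>n x. g x n" M "\<lambda>_. borel"] assms(1) by simp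
  then show "g \<in> borel_measurable M"
    using measurable_cong_sets[OF refl sets_PiM_equal_borel] by blast
qed (use assms in auto)

lemma iterated_transfer_zero: "f 0 v = 0 \<Longrightarrow> iterated_transfer \<sigma> D f n v = 0"
  by (cases n) auto

text \<open>
  If each test function vanishes on all preimages of the path \<open>w\<close> other than the path itself, only
  one branch of the iterated sum survives.
\<close>

lemma iterated_transfer_along_path:
  assumes fin: "\<And>z. z \<in> circle \<Longrightarrow> finite (preimages \<sigma> z)" and "w \<in> solenoid \<sigma>"
    and "\<And>i v. v \<in> preimages \<sigma> (w i) \<Longrightarrow> v \<noteq> w (Suc i) \<Longrightarrow> f (Suc i) v = 0"
  shows "iterated_transfer \<sigma> D f n (w 0)
    = f 0 (w 0) * (\<Prod>i<n. complex_of_real (D (w (Suc i))) * f (Suc i) (w (Suc i)))"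
  using assms(2,3)
proof (induction n arbitrary: f w)
  case (Suc n)
  let ?g = "iterated_transfer \<sigma> D (\<lambda>i. f (Suc i)) n"
  let ?w = "\<lambda>i. w (Suc i)"
  have w: "w i \<in> circle" "w (Suc i) \<in> preimages \<sigma> (w i)" for i
    using Suc.prems(1) by (auto simp: solenoid_def preimages_def)
  have "transfer_op \<sigma> D ?g (w 0) = (\<Sum>v\<in>{w 1}. complex_of_real (D v) * ?g v)"
    unfolding transfer_op_def
  proof (rule sum.mono_neutral_right[OF fin[OF w(1)]])
    show "\<forall>v\<in>preimages \<sigma> (w 0) - {w 1}. complex_of_real (D v) * ?g v = 0"
      using Suc.prems(2)[of _ 0] by (auto intro!: iterated_transfer_zero)
  qed (use w(2)[of 0] in auto)
  moreover have "?g (w 1) = f 1 (w 1) * (\<Prod>i<n. complex_of_real (D (w (Suc (Suc i)))) * f (Suc (Suc i)) (w (Suc (Suc i))))"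
    using Suc.IH[of ?w "\<lambda>i. f (Suc i)"] Suc.prems by (auto simp: solenoid_def)
  ultimately show ?case
    by (simp add: prod.lessThan_Suc_shift mult_ac del: prod.lessThan_Suc)
qed simp

lemma path_measure_space:
  assumes "is_path_measure \<sigma> D z P"
  shows "space P = solenoid \<sigma>"
  using assms sets_eq_imp_space_eq[of P "restrict_space borel (solenoid \<sigma>)"]
  by (auto simp: is_path_measure_def space_restrict_space)

text \<open>
  The integral formula only speaks of continuous functions of the coordinates. As each fibre is
  finite, the Lagrange polynomial that is \<open>1\<close> at \<open>w (Suc j)\<close> and \<open>0\<close> at the other preimages of
  \<open>w j\<close> is continuous, and a product of these agrees almost surely with the indicator of the
  cylinder.
\<close>

lemma path_measure_cylinder:
  assumes P: "is_path_measure \<sigma> D z P"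
    and fin: "\<And>z. z \<in> circle \<Longrightarrow> finite (preimages \<sigma> z)"
    and w: "w \<in> solenoid \<sigma>" "w 0 = z"
  shows "{\<zeta>\<in>solenoid \<sigma>. \<forall>i\<le>n. \<zeta> i = w i} \<in> sets P"
    and "measure P {\<zeta>\<in>solenoid \<sigma>. \<forall>i\<le>n. \<zeta> i = w i} = (\<Prod>i<n. D (w (Suc i)))"
proof -
  let ?A = "{\<zeta>\<in>solenoid \<sigma>. \<forall>i\<le>n. \<zeta> i = w i}"
  have sets: "sets P = sets (restrict_space borel (solenoid \<sigma>))"
    using P by (simp add: is_path_measure_def)
  let ?R = "restrict_space borel (solenoid \<sigma>) :: (nat \<Rightarrow> complex) measure"
  have "(\<lambda>\<zeta>. \<zeta> i) -` {w i} \<inter> space ?R \<in> sets ?R" for i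
    by (rule measurable_sets[OF measurable_coordinate]) simp
  then have "(\<Inter>i\<in>{..n}. (\<lambda>\<zeta>. \<zeta> i) -` {w i} \<inter> space ?R) \<in> sets ?R"
    by (intro sets.finite_INT) auto
  also have "(\<Inter>i\<in>{..n}. (\<lambda>\<zeta>. \<zeta> i) -` {w i} \<inter> space ?R) = ?A"
    by (auto simp: space_restrict_space)
  finally show A: "?A \<in> sets P"
    unfolding sets .
  define f where "f i = (case i of 0 \<Rightarrow> \<lambda>_. 1
    | Suc j \<Rightarrow> \<lambda>v. \<Prod>p\<in>preimages \<sigma> (w j) - {w (Suc j)}. (v - p) * inverse (w (Suc j) - p))" for i
  have f_cont: "continuous_on circle (f i)" for i
    by (cases i) (auto simp: f_def intro!: continuous_intros)
  have f_one: "f i (w i) = 1" for i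
    by (cases i) (auto simp: f_def simp del: right_inverse intro!: prod.neutral right_inverse)
  have f_zero: "f (Suc j) v = 0" if "v \<in> preimages \<sigma> (w j)" "v \<noteq> w (Suc j)" for j v
  proof -
    have "finite (preimages \<sigma> (w j))" using w by (intro fin) (auto simp: solenoid_def)
    then show ?thesis using that by (auto simp: f_def intro!: prod_zero)
  qed
  have f_ind: "(\<Prod>i\<le>n. f i (\<zeta> i)) = complex_of_real (indicator ?A \<zeta>)"
    if \<zeta>: "\<zeta> \<in> solenoid \<sigma>" "\<zeta> 0 = w 0" for \<zeta>
  proof (cases "\<forall>i\<le>n. \<zeta> i = w i")
    case True
    then show ?thesis using \<zeta> f_one by (auto simp: indicator_def)
  next
    case False
    \<comment> \<open>At the first disagreement with \<open>w\<close>, the test function sees another preimage of \<open>w j\<close>.\<close>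
    define i where "i = (LEAST i. i \<le> n \<and> \<zeta> i \<noteq> w i)"
    have i: "i \<le> n" "\<zeta> i \<noteq> w i"
      using LeastI_ex[of "\<lambda>i. i \<le> n \<and> \<zeta> i \<noteq> w i"] False by (auto simp: i_def)
    then obtain j where j: "i = Suc j" using \<zeta> by (cases i) auto
    then have "\<zeta> j = w j"
      using not_less_Least[of j "\<lambda>i. i \<le> n \<and> \<zeta> i \<noteq> w i"] i(1) by (auto simp: i_def)
    then have "f i (\<zeta> i) = 0"
      using \<zeta>(1) i(2) unfolding j by (intro f_zero) (auto simp: preimages_def solenoid_def)
    then show ?thesis using i False by (auto simp: indicator_def intro!: prod_zero)
  qed
  interpret prob_space P using P by (simp add: is_path_measure_def)
  have "AE \<zeta> in P. \<zeta> 0 = w 0"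
    using P w by (simp add: is_path_measure_def solenoid_proj_def)
  then have AE: "AE \<zeta> in P. (\<Prod>i\<le>n. f i (\<zeta> i)) = complex_of_real (indicator ?A \<zeta>)"
    using AE_space by eventually_elim (simp add: f_ind path_measure_space[OF P])
  have coord [measurable]: "(\<lambda>\<zeta>. \<zeta> i) \<in> borel_measurable P" for i
    using measurable_coordinate measurable_cong_sets[OF sets refl] by blast
  have f_meas: "(\<lambda>\<zeta>. f i (\<zeta> i)) \<in> borel_measurable P" for i
    by (cases i) (simp_all add: f_def)
  have "(LINT \<zeta>|P. indicator ?A \<zeta> :: real) = measure P ?A"
    using A by (simp only: Bochner_Integration.integral_indicator sets.Int_space_eq2)
  then have "complex_of_real (measure P ?A) = (LINT \<zeta>|P. complex_of_real (indicator ?A \<zeta>))"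
    by (simp only: integral_complex_of_real)
  also have "\<dots> = (LINT \<zeta>|P. (\<Prod>i\<le>n. f i (\<zeta> i)))"
  proof (rule integral_cong_AE)
    show "(\<lambda>\<zeta>. complex_of_real (indicator ?A \<zeta>)) \<in> borel_measurable P"
      using borel_measurable_indicator[OF A] by (rule measurable_compose) simp
    show "(\<lambda>\<zeta>. \<Prod>i\<le>n. f i (\<zeta> i)) \<in> borel_measurable P"
      by (intro borel_measurable_prod f_meas)
    show "AE \<zeta> in P. complex_of_real (indicator ?A \<zeta>) = (\<Prod>i\<le>n. f i (\<zeta> i))"
      using AE by eventually_elim (rule sym)
  qed
  also have "\<dots> = iterated_transfer \<sigma> D f n (w 0)"
    using P f_cont w(2) by (simp add: is_path_measure_def)
  also have "\<dots> = complex_of_real (\<Prod>i<n. D (w (Suc i)))"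
    by (subst iterated_transfer_along_path[OF fin w(1)]) (auto simp: f_zero f_one)
  finally show "measure P ?A = (\<Prod>i<n. D (w (Suc i)))"
    using of_real_eq_iff by blast
qed

lemma path_measure_singleton:
  assumes P: "is_path_measure \<sigma> D z P"
    and fin: "\<And>z. z \<in> circle \<Longrightarrow> finite (preimages \<sigma> z)"
    and w: "w \<in> solenoid \<sigma>" "w 0 = z"
  shows "{w} \<in> sets P" "(\<lambda>n. \<Prod>i<n. D (w (Suc i))) \<longlonglongrightarrow> measure P {w}"
proof -
  let ?A = "\<lambda>n. {\<zeta>\<in>solenoid \<sigma>. \<forall>i\<le>n. \<zeta> i = w i}"
  interpret prob_space P using P by (simp add: is_path_measure_def)
  have eq: "(\<Inter>n. ?A n) = {w}" using w(1) by auto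
  have A: "?A n \<in> sets P" for n
    by (rule path_measure_cylinder(1)[OF P fin w])
  have "(\<Inter>n. ?A n) \<in> sets P"
    by (intro sets.countable_INT image_subsetI A UNIV_not_empty)
  then show "{w} \<in> sets P" by (simp only: eq)
  have "(\<lambda>n. measure P (?A n)) \<longlonglongrightarrow> measure P (\<Inter>n. ?A n)"
    by (intro finite_Lim_measure_decseq image_subsetI A) (auto simp: decseq_def)
  then show "(\<lambda>n. \<Prod>i<n. D (w (Suc i))) \<longlonglongrightarrow> measure P {w}"
    by (simp only: eq path_measure_cylinder(2)[OF P fin w])
qed

section \<open>The line inside the solenoid\<close>

text \<open>
  The assumption \<open>D_log\<close> combines \<open>D 1 = 1\<close> with \<open>ln D = O(x)\<close> at the base point. In
  \<open>D_nonzero\<close> the points \<open>\<tau> 1\<close> and \<open>\<tau> (-1)\<close> are the ones nearest to \<open>0\<close>, on either side,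
  among the nonzero points that \<open>e\<close> maps to preimages of \<open>1\<close>, so that the bound is the \<open>r\<close> of the
  theorem.
\<close>

locale weighted_solenoid = expanding_lift \<phi> N
  for \<phi> N +
  fixes \<sigma> :: "complex \<Rightarrow> complex" and D :: "complex \<Rightarrow> real"
    and \<nu> :: "complex \<Rightarrow> (nat \<Rightarrow> complex) measure"
  assumes sigma_turn: "\<And>x. \<sigma> (turn x) = turn (primitive \<phi> x)"
    and D_nonneg: "\<And>w. 0 \<le> D w"
    and D_sum: "\<And>z. z \<in> circle \<Longrightarrow> (\<Sum>w\<in>preimages \<sigma> z. D w) = 1"
    and D_cont: "continuous_on UNIV (\<lambda>x. D (turn x))"
    and D_log: "\<exists>C>0. \<exists>\<delta>>0. \<forall>x. \<bar>x\<bar> < \<delta> \<longrightarrow> exp (- C * \<bar>x\<bar>) \<le> D (turn x)"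
    and D_nonzero: "\<And>x. \<bar>x\<bar> < min (\<tau> 1) (- \<tau> (-1)) \<Longrightarrow> D (turn x) \<noteq> 0"
    and path: "\<And>z. z \<in> circle \<Longrightarrow> is_path_measure \<sigma> D z (\<nu> z)"
begin

definition line_path :: "real \<Rightarrow> nat \<Rightarrow> complex" where
  "line_path x n = turn ((\<tau> ^^ n) x)"

text \<open>
  The left inverse of \<open>line_path\<close>: late coordinates of a path \<open>line_path x\<close> are close to \<open>1\<close>, so
  that the principal angle recovers \<open>\<tau>\<^sup>n x\<close>, and applying \<open>\<Phi>\<^sup>n\<close> gives back \<open>x\<close>. Written as a limit,
  it is visibly Borel.
\<close>

definition line_coord :: "(nat \<Rightarrow> complex) \<Rightarrow> real" where
  "line_coord \<zeta> = lim (\<lambda>n. (\<Phi> ^^ n) (angle (\<zeta> n)))"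

text \<open>
  The infinite product \<open>\<Prod>\<^sub>n\<^sub>\<ge>\<^sub>1 D (e (\<tau>\<^sup>n x))\<close>. It will be the density of the solenoid measure on
  the line.
\<close>

definition mass :: "real \<Rightarrow> real" where
  "mass x = lim (\<lambda>n. \<Prod>i<n. D (turn ((\<tau> ^^ Suc i) x)))"

lemma line_path_0 [simp]: "line_path x 0 = turn x"
  by (simp add: line_path_def)

lemma line_path_solenoid: "line_path x \<in> solenoid \<sigma>"
  by (simp add: solenoid_def line_path_def sigma_turn)

lemma line_path_measurable: "line_path \<in> borel \<rightarrow>\<^sub>M restrict_space borel (solenoid \<sigma>)"
proof (rule measurable_into_solenoid)
  fix n show "(\<lambda>x. line_path x n) \<in> borel_measurable borel"
    unfolding line_path_def
    using measurable_compose[OF tau_iter_measurable measurable_turn] by simp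
qed (rule line_path_solenoid)

lemma solenoid_map_line_path: "solenoid_map \<sigma> (line_path x) = line_path (\<Phi> x)"
proof
  fix n show "solenoid_map \<sigma> (line_path x) n = line_path (\<Phi> x) n"
  proof (cases n)
    case (Suc k)
    have "(\<tau> ^^ Suc k) (\<Phi> x) = (\<tau> ^^ k) x"
      by (simp only: funpow_Suc_right o_apply tau_Phi)
    then show ?thesis by (simp only: Suc solenoid_map_def line_path_def nat.case)
  qed (simp add: solenoid_map_def line_path_def sigma_turn)
qed

lemma line_coord_line_path [simp]: "line_coord (line_path x) = x"
proof -
  have "\<forall>\<^sub>F n in sequentially. \<bar>(\<tau> ^^ n) x\<bar> < 1 / 2"
    using tendstoD[OF tau_iter_tendsto_0, of "1 / 2" x] by (simp add: dist_real_def)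
  then have "\<forall>\<^sub>F n in sequentially. (\<Phi> ^^ n) (angle (line_path x n)) = x"
    by eventually_elim (simp add: line_path_def angle_turn)
  then have "(\<lambda>n. (\<Phi> ^^ n) (angle (line_path x n))) \<longlonglongrightarrow> x"
    by (rule tendsto_eventually)
  then show ?thesis unfolding line_coord_def by (rule limI)
qed

lemma line_coord_measurable:
  "line_coord \<in> borel_measurable (restrict_space borel (solenoid \<sigma>))"
proof -
  have "(\<lambda>\<zeta>. (\<Phi> ^^ n) (angle (\<zeta> n))) \<in> borel_measurable (restrict_space borel (solenoid \<sigma>))" for n
    using measurable_compose[OF measurable_compose[OF measurable_coordinate measurable_angle]
        Phi_iter_measurable] .
  then show ?thesis
    unfolding line_coord_def[abs_def] by (rule borel_measurable_lim_metric)
qed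

lemma preimages_finite: "z \<in> circle \<Longrightarrow> finite (preimages \<sigma> z)"
  using D_sum[of z] sum.infinite[of "preimages \<sigma> z" D] by fastforce

lemma N_pos: "0 < N"
  using Phi_less_iff[of 0 1] total by simp

lemma preimages_turn:
  "preimages \<sigma> (turn x) = (\<lambda>j. turn (\<tau> (x + of_int j))) ` {0..<int N}"
proof (intro subset_antisym subsetI)
  fix w assume w: "w \<in> preimages \<sigma> (turn x)"
  define t where "t = angle w"
  have t: "w = turn t" using w by (simp add: t_def preimages_def turn_angle)
  then have "turn x = turn (\<Phi> t)" using w by (simp add: preimages_def sigma_turn)
  then obtain k :: int where k: "\<Phi> t = x + of_int k" using turn_eq_iff by blast
  define j where "j = k mod int N"
  have "j \<in> {0..<int N}" using N_pos by (simp add: j_def)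
  have "of_int k = (of_int j + of_int ((k div int N) * int N) :: real)"
    unfolding j_def of_int_add[symmetric] by (metis add.commute div_mult_mod_eq)
  then have "\<tau> (\<Phi> t) = \<tau> (x + of_int j) + of_int (k div int N)"
    using k tau_add_int[of "x + of_int j" "k div int N"] by (simp add: add.assoc)
  then have "w = turn (\<tau> (x + of_int j))" using t by (metis tau_Phi turn_add_int)
  then show "w \<in> (\<lambda>j. turn (\<tau> (x + of_int j))) ` {0..<int N}"
    using \<open>j \<in> {0..<int N}\<close> by blast
next
  fix w assume "w \<in> (\<lambda>j. turn (\<tau> (x + of_int j))) ` {0..<int N}"
  then show "w \<in> preimages \<sigma> (turn x)"
    by (auto simp: preimages_def sigma_turn)
qed

lemma preimages_turn_inj: "inj_on (\<lambda>j::int. turn (\<tau> (x + of_int j))) {0..<int N}"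
proof (rule inj_onI)
  fix i j :: int
  assume ij: "i \<in> {0..<int N}" "j \<in> {0..<int N}"
    and "turn (\<tau> (x + of_int i)) = turn (\<tau> (x + of_int j))"
  then obtain k :: int where "\<tau> (x + of_int j) = \<tau> (x + of_int i) + of_int k"
    using turn_eq_iff by blast
  then have "\<Phi> (\<tau> (x + of_int j)) = \<Phi> (\<tau> (x + of_int i)) + of_int (k * int N)"
    by (simp only: Phi_add_int)
  then have "of_int j = (of_int (i + k * int N) :: real)" by simp
  then have "j = i + k * int N" by (simp only: of_int_eq_iff)
  then have "j mod int N = i mod int N" by simp
  then show "i = j" using ij by simp
qed

lemma D_sum_turn: "(\<Sum>j\<in>{0..<int N}. D (turn (\<tau> (x + of_int j)))) = 1"
  using D_sum[of "turn x"] preimages_turn_inj[of x]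
  by (simp add: preimages_turn sum.reindex)

text \<open>
  Convergence of the product comes for free: its partial products are the measures of the
  cylinders that shrink to the point.
\<close>

lemma singleton_path:
  shows "{line_path x} \<in> sets (\<nu> (turn x))"
    and "(\<lambda>n. \<Prod>i<n. D (turn ((\<tau> ^^ Suc i) x))) \<longlonglongrightarrow> mass x"
    and "measure (\<nu> (turn x)) {line_path x} = mass x"
proof -
  note P = path_measure_singleton[OF path[OF turn_in_circle] preimages_finite line_path_solenoid
      line_path_0, of x]
  show "{line_path x} \<in> sets (\<nu> (turn x))" by (rule P(1))
  have *: "(\<lambda>n. \<Prod>i<n. D (turn ((\<tau> ^^ Suc i) x))) \<longlonglongrightarrow> measure (\<nu> (turn x)) {line_path x}"
    using P(2) by (simp only: line_path_def[of x "Suc i" for i])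
  then show "measure (\<nu> (turn x)) {line_path x} = mass x"
    unfolding mass_def by (rule limI[symmetric])
  with * show "(\<lambda>n. \<Prod>i<n. D (turn ((\<tau> ^^ Suc i) x))) \<longlonglongrightarrow> mass x"
    by simp
qed

lemma mass_nonneg: "0 \<le> mass x"
  using singleton_path(3)[of x] by (metis measure_nonneg)

lemma D_turn_measurable [measurable]: "(\<lambda>x. D (turn x)) \<in> borel_measurable borel"
  by (intro borel_measurable_continuous_onI D_cont)

lemma mass_measurable [measurable]: "mass \<in> borel_measurable borel"
proof -
  have "(\<lambda>x. D (turn ((\<tau> ^^ Suc i) x))) \<in> borel_measurable borel" for i
    using measurable_compose[OF tau_iter_measurable D_turn_measurable] .
  then have "(\<lambda>x. \<Prod>i<n. D (turn ((\<tau> ^^ Suc i) x))) \<in> borel_measurable borel" for n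
    by (intro borel_measurable_prod)
  then show ?thesis
    unfolding mass_def[abs_def] by (rule borel_measurable_lim_metric)
qed

text \<open>
  Passing from \<open>x\<close> to \<open>\<Phi> x\<close> prepends one factor to the product.
\<close>

lemma mass_Phi: "mass (\<Phi> x) = D (turn x) * mass x"
proof -
  have shift: "(\<tau> ^^ Suc n) (\<Phi> x) = (\<tau> ^^ n) x" for n
    by (simp only: funpow_Suc_right o_apply tau_Phi)
  have "(\<lambda>n. \<Prod>i<Suc n. D (turn ((\<tau> ^^ Suc i) (\<Phi> x)))) \<longlonglongrightarrow> mass (\<Phi> x)"
    using singleton_path(2)[of "\<Phi> x"] by (rule LIMSEQ_Suc)
  also have "(\<lambda>n. \<Prod>i<Suc n. D (turn ((\<tau> ^^ Suc i) (\<Phi> x))))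
      = (\<lambda>n. D (turn x) * (\<Prod>i<n. D (turn ((\<tau> ^^ Suc i) x))))"
    unfolding shift prod.lessThan_Suc_shift by simp
  finally show ?thesis
    using tendsto_mult_left[OF singleton_path(2)[of x], of "D (turn x)"] LIMSEQ_unique by blast
qed

lemma mass_tau: "mass x = D (turn (\<tau> x)) * mass (\<tau> x)"
  using mass_Phi[of "\<tau> x"] by simp

lemma mass_tau_iter: "mass x = (\<Prod>i<n. D (turn ((\<tau> ^^ Suc i) x))) * mass ((\<tau> ^^ n) x)"
proof (induction n)
  case (Suc n)
  then show ?case using mass_tau[of "(\<tau> ^^ n) x"] by simp
qed simp

text \<open>
  The bound \<open>exp (- C |x|)\<close> for one factor survives the infinite product, as \<open>|\<tau>\<^sup>i x|\<close> decays
  geometrically; only \<open>C\<close> changes to \<open>C / (1 - q)\<close>.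
\<close>

lemma mass_near_0: "\<exists>C>0. \<exists>\<delta>>0. \<forall>x. \<bar>x\<bar> < \<delta> \<longrightarrow> exp (- C * \<bar>x\<bar>) \<le> mass x"
proof -
  obtain q where q: "0 < q" "q < 1" "\<And>n x. \<bar>(\<tau> ^^ n) x\<bar> \<le> q ^ n * \<bar>x\<bar>"
    using tau_iter_contracts by blast
  obtain C \<delta> where C: "C > 0" "\<delta> > 0" "\<And>x. \<bar>x\<bar> < \<delta> \<Longrightarrow> exp (- C * \<bar>x\<bar>) \<le> D (turn x)"
    using D_log by blast
  have "exp (- (C / (1 - q)) * \<bar>x\<bar>) \<le> mass x" if x: "\<bar>x\<bar> < \<delta>" for x
  proof (rule LIMSEQ_le_const[OF singleton_path(2)], intro exI allI impI)
    fix n :: nat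
    have D_i: "exp (- C * (q ^ i * \<bar>x\<bar>)) \<le> D (turn ((\<tau> ^^ Suc i) x))" for i
    proof -
      have "q ^ Suc i * \<bar>x\<bar> \<le> q ^ i * \<bar>x\<bar>" "q ^ i * \<bar>x\<bar> \<le> 1 * \<bar>x\<bar>"
        using q by (intro mult_right_mono power_le_one power_Suc_le_self; simp)+
      then have "\<bar>(\<tau> ^^ Suc i) x\<bar> \<le> q ^ i * \<bar>x\<bar>" "\<bar>(\<tau> ^^ Suc i) x\<bar> < \<delta>"
        using q(3)[of "Suc i" x] x by linarith+
      then have "exp (- C * (q ^ i * \<bar>x\<bar>)) \<le> exp (- C * \<bar>(\<tau> ^^ Suc i) x\<bar>)"
        "exp (- C * \<bar>(\<tau> ^^ Suc i) x\<bar>) \<le> D (turn ((\<tau> ^^ Suc i) x))"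
        using C by (auto intro!: mult_left_mono simp del: funpow.simps)
      then show ?thesis by linarith
    qed
    have "(\<Sum>i<n. q ^ i) \<le> 1 / (1 - q)"
    proof -
      have "(\<Sum>i<n. q ^ i) = (1 - q ^ n) / (1 - q)"
        using q by (simp add: sum_gp_strict)
      also have "\<dots> \<le> 1 / (1 - q)" using q by (intro divide_right_mono) auto
      finally show ?thesis .
    qed
    then have "C * \<bar>x\<bar> * (\<Sum>i<n. q ^ i) \<le> C * \<bar>x\<bar> * (1 / (1 - q))"
      using C by (intro mult_left_mono) auto
    then have "exp (- (C / (1 - q)) * \<bar>x\<bar>) \<le> exp (\<Sum>i<n. - C * (q ^ i * \<bar>x\<bar>))"
      by (simp add: sum_distrib_left sum_distrib_right sum_negf mult_ac)
    also have "\<dots> = (\<Prod>i<n. exp (- C * (q ^ i * \<bar>x\<bar>)))" by (simp add: exp_sum)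
    also have "\<dots> \<le> (\<Prod>i<n. D (turn ((\<tau> ^^ Suc i) x)))"
      by (intro prod_mono conjI D_i) auto
    finally show "exp (- (C / (1 - q)) * \<bar>x\<bar>) \<le> (\<Prod>i<n. D (turn ((\<tau> ^^ Suc i) x)))" .
  qed
  moreover have "C / (1 - q) > 0" using C q by simp
  ultimately show ?thesis using C(2) by blast
qed

text \<open>
  Split off finitely many factors; the remaining tail is the mass of a point near \<open>0\<close>.
\<close>

lemma mass_pos:
  assumes "\<And>n. D (turn ((\<tau> ^^ Suc n) x)) \<noteq> 0"
  shows "0 < mass x"
proof -
  obtain C \<delta> where C: "C > 0" "\<delta> > 0" "\<And>x. \<bar>x\<bar> < \<delta> \<Longrightarrow> exp (- C * \<bar>x\<bar>) \<le> mass x"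
    using mass_near_0 by blast
  obtain n where "\<bar>(\<tau> ^^ n) x\<bar> < \<delta>"
    using tendstoD[OF tau_iter_tendsto_0 C(2), of x]
    by (auto simp: dist_real_def eventually_sequentially)
  then have "0 < mass ((\<tau> ^^ n) x)" using C(3) less_le_trans[OF exp_gt_zero] by blast
  moreover have "0 < (\<Prod>i<n. D (turn ((\<tau> ^^ Suc i) x)))"
    using assms D_nonneg by (intro prod_pos) (auto simp: less_le simp del: funpow.simps)
  ultimately show ?thesis using mass_tau_iter[of x n] by simp
qed

end

section \<open>The path measures live on the line\<close>

lemma nn_integral_int_residues:
  fixes f :: "int \<Rightarrow> ennreal"
  assumes "0 < N"
  shows "(\<integral>\<^sup>+k. f k \<partial>count_space UNIV)
    = (\<Sum>j\<in>{0..<int N}. \<integral>\<^sup>+l. f (j + l * int N) \<partial>count_space UNIV)"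
proof -
  let ?R = "{0..<int N}"
  have bij: "bij_betw (\<lambda>p. fst p + snd p * int N) (?R \<times> UNIV) UNIV"
  proof (rule bij_betwI[where g = "\<lambda>k. (k mod int N, k div int N)"])
    show "(\<lambda>k. (k mod int N, k div int N)) \<in> UNIV \<rightarrow> ?R \<times> UNIV"
      using assms by auto
  qed (use assms in \<open>auto simp: mult.commute\<close>)
  have "(\<integral>\<^sup>+k. f k \<partial>count_space UNIV) = (\<integral>\<^sup>+p. f (fst p + snd p * int N) \<partial>count_space (?R \<times> UNIV))"
    by (rule nn_integral_bij_count_space[OF bij, symmetric])
  also have "\<dots> = (\<integral>\<^sup>+p. f (fst p + snd p * int N) * indicator (?R \<times> UNIV) p \<partial>count_space UNIV)"
    by (rule nn_integral_count_space_indicator) simp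
  also have "\<dots> = (\<integral>\<^sup>+j. \<integral>\<^sup>+l. f (j + l * int N) * indicator ?R j \<partial>count_space UNIV \<partial>count_space UNIV)"
    by (subst nn_integral_fst_count_space[symmetric]) (simp add: indicator_times)
  also have "\<dots> = (\<integral>\<^sup>+j. (\<integral>\<^sup>+l. f (j + l * int N) \<partial>count_space UNIV) * indicator ?R j \<partial>count_space UNIV)"
    by (intro nn_integral_cong nn_integral_multc) simp
  also have "\<dots> = (\<integral>\<^sup>+j. (\<integral>\<^sup>+l. f (j + l * int N) \<partial>count_space UNIV) \<partial>count_space ?R)"
    by (rule nn_integral_count_space_indicator[symmetric]) simp
  also have "\<dots> = (\<Sum>j\<in>?R. \<integral>\<^sup>+l. f (j + l * int N) \<partial>count_space UNIV)"
    by (rule nn_integral_count_space_finite) simp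
  finally show ?thesis .
qed

text \<open>
  A point of the line is a point of \<open>[0, 1)\<close> together with an integer. This unfolds integration
  over the circle and then over the fibre into integration over the line.
\<close>

lemma nn_integral_lborel_unit_intervals:
  assumes [measurable]: "g \<in> borel_measurable borel"
  shows "(\<integral>\<^sup>+x. g x \<partial>lborel)
    = (\<integral>\<^sup>+t. (\<integral>\<^sup>+k. g (t + of_int k) \<partial>count_space UNIV) * indicator {0..<1::real} t \<partial>lborel)"
proof -
  have one: "(\<integral>\<^sup>+k. indicator {0..<1::real} (x - of_int k) \<partial>count_space (UNIV::int set)) = 1" for x
  proof -
    have "indicator {0..<1::real} (x - of_int k) = (indicator {\<lfloor>x\<rfloor>} k :: ennreal)" for k :: int
      by (auto simp: indicator_def floor_eq_iff) linarith+
    then show ?thesis by (simp add: emeasure_count_space)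
  qed
  have "(\<integral>\<^sup>+x. g x \<partial>lborel)
      = (\<integral>\<^sup>+x. (\<integral>\<^sup>+k. g x * indicator {0..<1::real} (x - of_int k) \<partial>count_space (UNIV::int set)) \<partial>lborel)"
    by (simp add: nn_integral_cmult one)
  also have "\<dots> = (\<integral>\<^sup>+k. (\<integral>\<^sup>+x. g x * indicator {0..<1::real} (x - of_int k) \<partial>lborel) \<partial>count_space (UNIV::int set))"
    by (rule nn_integral_count_space_nn_integral) simp_all
  also have "\<dots> = (\<integral>\<^sup>+k. (\<integral>\<^sup>+t. g (t + of_int k) * indicator {0..<1::real} t \<partial>lborel) \<partial>count_space (UNIV::int set))"
  proof (rule nn_integral_cong)
    fix k :: int
    show "(\<integral>\<^sup>+x. g x * indicator {0..<1::real} (x - of_int k) \<partial>lborel)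
        = (\<integral>\<^sup>+t. g (t + of_int k) * indicator {0..<1::real} t \<partial>lborel)"
      by (subst nn_integral_real_affine[where c = 1 and t = "of_int k"]) (simp_all add: add.commute)
  qed
  also have "\<dots> = (\<integral>\<^sup>+t. (\<integral>\<^sup>+k. g (t + of_int k) * indicator {0..<1::real} t \<partial>count_space (UNIV::int set)) \<partial>lborel)"
    by (rule nn_integral_count_space_nn_integral[symmetric]) simp_all
  also have "\<dots> = (\<integral>\<^sup>+t. (\<integral>\<^sup>+k. g (t + of_int k) \<partial>count_space UNIV) * indicator {0..<1::real} t \<partial>lborel)"
    by (intro nn_integral_cong nn_integral_multc) simp
  finally show ?thesis .
qed

context weighted_solenoid
begin

definition fibre_lines :: "real \<Rightarrow> (nat \<Rightarrow> complex) set" where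
  "fibre_lines x = range (\<lambda>k::int. line_path (x + of_int k))"

text \<open>
  The part of \<open>\<nu>\<^sub>z\<close>, \<open>z = e x\<close>, carried by the image of the line; the aim is that this is everything.
\<close>

definition line_prob :: "real \<Rightarrow> real" where
  "line_prob x = measure (\<nu> (turn x)) (fibre_lines x)"

lemma prob_nu: "prob_space (\<nu> (turn x))"
  using path[OF turn_in_circle, of x] by (simp add: is_path_measure_def)

lemma sets_nu: "sets (\<nu> (turn x)) = sets (restrict_space borel (solenoid \<sigma>))"
  using path[OF turn_in_circle, of x] by (simp add: is_path_measure_def)

lemma fibre_singleton:
  "{line_path (x + of_int k)} \<in> sets (\<nu> (turn x))"
  "emeasure (\<nu> (turn x)) {line_path (x + of_int k)} = ennreal (mass (x + of_int k))"
proof -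
  interpret prob_space "\<nu> (turn x)" by (rule prob_nu)
  show "{line_path (x + of_int k)} \<in> sets (\<nu> (turn x))"
    "emeasure (\<nu> (turn x)) {line_path (x + of_int k)} = ennreal (mass (x + of_int k))"
    using singleton_path(1,3)[of "x + of_int k"] by (simp_all add: emeasure_eq_measure)
qed

lemma line_path_inj: "line_path x = line_path y \<longleftrightarrow> x = y"
  by (metis line_coord_line_path)

lemma emeasure_fibre_lines:
  "A \<inter> fibre_lines x \<in> sets (\<nu> (turn x))"
  "emeasure (\<nu> (turn x)) (A \<inter> fibre_lines x)
    = (\<integral>\<^sup>+k. ennreal (mass (x + of_int k)) * indicator A (line_path (x + of_int k))
        \<partial>count_space (UNIV::int set))"
proof -
  let ?p = "\<lambda>k::int. line_path (x + of_int k)"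
  let ?K = "{k. ?p k \<in> A}"
  have eq: "A \<inter> fibre_lines x = ?p ` ?K" by (auto simp: fibre_lines_def)
  have sing: "{w} \<in> sets (\<nu> (turn x))" if "w \<in> ?p ` ?K" for w
    using that fibre_singleton(1) by auto
  show "A \<inter> fibre_lines x \<in> sets (\<nu> (turn x))"
    unfolding eq by (intro sets.countable[OF sing]) auto
  have "emeasure (\<nu> (turn x)) (?p ` ?K) = (\<integral>\<^sup>+w. emeasure (\<nu> (turn x)) {w} \<partial>count_space (?p ` ?K))"
    by (intro emeasure_countable_singleton sing) auto
  also have "\<dots> = (\<integral>\<^sup>+k. emeasure (\<nu> (turn x)) {?p k} \<partial>count_space ?K)"
    by (rule nn_integral_bij_count_space[symmetric])
       (auto simp: bij_betw_def inj_on_def line_path_inj)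
  also have "\<dots> = (\<integral>\<^sup>+k. ennreal (mass (x + of_int k)) \<partial>count_space ?K)"
    by (simp add: fibre_singleton(2))
  also have "\<dots> = (\<integral>\<^sup>+k. ennreal (mass (x + of_int k)) * indicator A (?p k) \<partial>count_space UNIV)"
    using nn_integral_restrict_space[of ?K "count_space UNIV" "\<lambda>k. ennreal (mass (x + of_int k))"]
    by (simp add: restrict_count_space indicator_def)
  finally show "emeasure (\<nu> (turn x)) (A \<inter> fibre_lines x)
    = (\<integral>\<^sup>+k. ennreal (mass (x + of_int k)) * indicator A (?p k) \<partial>count_space UNIV)"
    by (simp only: eq)
qed

lemma line_prob_eq:
  "ennreal (line_prob x) = (\<integral>\<^sup>+k. ennreal (mass (x + of_int k)) \<partial>count_space (UNIV::int set))"
proof -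
  interpret prob_space "\<nu> (turn x)" by (rule prob_nu)
  show ?thesis using emeasure_fibre_lines(2)[where A = UNIV and x = x]
    by (simp add: line_prob_def emeasure_eq_measure)
qed

lemma line_prob_bounds: "0 \<le> line_prob x" "line_prob x \<le> 1"
proof -
  interpret prob_space "\<nu> (turn x)" by (rule prob_nu)
  show "0 \<le> line_prob x" "line_prob x \<le> 1" by (simp_all add: line_prob_def)
qed

lemma mass_le_line_prob: "mass x \<le> line_prob x"
proof -
  interpret prob_space "\<nu> (turn x)" by (rule prob_nu)
  have "measure (\<nu> (turn x)) {line_path x} \<le> measure (\<nu> (turn x)) (fibre_lines x)"
    using emeasure_fibre_lines(1)[where A = UNIV and x = x]
    by (intro finite_measure_mono) (auto simp: fibre_lines_def intro!: image_eqI[of _ _ 0])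
  then show ?thesis by (simp add: singleton_path(3) line_prob_def)
qed

lemma line_prob_add_int: "line_prob (x + of_int k) = line_prob x"
proof -
  have "fibre_lines (x + of_int k) = fibre_lines x"
  proof -
    have "line_path (x + of_int k + of_int j) \<in> fibre_lines x" for j
      unfolding fibre_lines_def by (rule image_eqI[of _ _ "k + j"]) (auto simp: add.assoc)
    moreover have "line_path (x + of_int j) \<in> fibre_lines (x + of_int k)" for j
      unfolding fibre_lines_def by (rule image_eqI[of _ _ "j - k"]) auto
    ultimately show ?thesis by (auto simp: fibre_lines_def[of "x + of_int k"] fibre_lines_def[of x])
  qed
  then show ?thesis by (simp add: line_prob_def)
qed

text \<open>
  Each integer is \<open>j + l N\<close> with \<open>0 \<le> j < N\<close>; the residue \<open>j\<close> selects the preimage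
  \<open>e (\<tau> (x + j))\<close> of \<open>e x\<close>, and \<open>l\<close> runs through the points of the line over that preimage.
\<close>

lemma line_prob_harmonic:
  "line_prob x = (\<Sum>j\<in>{0..<int N}. D (turn (\<tau> (x + of_int j))) * line_prob (\<tau> (x + of_int j)))"
proof -
  have "mass (x + of_int (j + l * int N))
      = D (turn (\<tau> (x + of_int j))) * mass (\<tau> (x + of_int j) + of_int l)" for j l
    using mass_tau[of "x + of_int (j + l * int N)"] tau_add_int[of "x + of_int j" l]
    by (simp add: add.assoc)
  then have "ennreal (line_prob x) = (\<Sum>j\<in>{0..<int N}.
      \<integral>\<^sup>+l. ennreal (D (turn (\<tau> (x + of_int j)))) * ennreal (mass (\<tau> (x + of_int j) + of_int l))
        \<partial>count_space UNIV)"
    unfolding line_prob_eq using N_pos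
    by (subst nn_integral_int_residues[of N]) (simp_all add: ennreal_mult D_nonneg mass_nonneg)
  also have "\<dots> = (\<Sum>j\<in>{0..<int N}.
      ennreal (D (turn (\<tau> (x + of_int j))) * line_prob (\<tau> (x + of_int j))))"
    by (simp add: nn_integral_cmult line_prob_eq ennreal_mult D_nonneg line_prob_bounds)
  also have "\<dots> = ennreal (\<Sum>j\<in>{0..<int N}.
      D (turn (\<tau> (x + of_int j))) * line_prob (\<tau> (x + of_int j)))"
    by (intro sum_ennreal) (simp add: D_nonneg line_prob_bounds)
  finally show ?thesis
    by (subst (asm) ennreal_inj) (auto intro!: sum_nonneg simp: D_nonneg line_prob_bounds)
qed

text \<open>
  In the harmonic relation for \<open>line_prob - \<alpha>\<close> all terms are nonnegative, so keeping only the
  branch \<open>j = 0\<close> gives one step of the estimate.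
\<close>

lemma line_prob_lower:
  assumes "\<And>x. \<alpha> \<le> line_prob x"
  shows "(\<Prod>i<n. D (turn ((\<tau> ^^ Suc i) x))) * (line_prob ((\<tau> ^^ n) x) - \<alpha>) \<le> line_prob x - \<alpha>"
proof (induction n)
  case (Suc n)
  have step: "D (turn (\<tau> y)) * (line_prob (\<tau> y) - \<alpha>) \<le> line_prob y - \<alpha>" for y
  proof -
    have "D (turn (\<tau> y)) * (line_prob (\<tau> y) - \<alpha>)
        \<le> (\<Sum>j\<in>{0..<int N}. D (turn (\<tau> (y + of_int j))) * (line_prob (\<tau> (y + of_int j)) - \<alpha>))"
      using member_le_sum[of 0 "{0..<int N}"
          "\<lambda>j. D (turn (\<tau> (y + of_int j))) * (line_prob (\<tau> (y + of_int j)) - \<alpha>)"]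
        N_pos D_nonneg assms by simp
    also have "\<dots> = line_prob y - \<alpha>"
      using line_prob_harmonic[of y] D_sum_turn[of y]
      by (simp add: right_diff_distrib sum_subtractf sum_distrib_right[symmetric])
    finally show ?thesis .
  qed
  have "(\<Prod>i<Suc n. D (turn ((\<tau> ^^ Suc i) x))) * (line_prob ((\<tau> ^^ Suc n) x) - \<alpha>)
      = (\<Prod>i<n. D (turn ((\<tau> ^^ Suc i) x)))
        * (D (turn (\<tau> ((\<tau> ^^ n) x))) * (line_prob (\<tau> ((\<tau> ^^ n) x)) - \<alpha>))"
    by simp
  also have "\<dots> \<le> (\<Prod>i<n. D (turn ((\<tau> ^^ Suc i) x))) * (line_prob ((\<tau> ^^ n) x) - \<alpha>)"
    by (intro mult_left_mono step prod_nonneg) (simp add: D_nonneg)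
  also have "\<dots> \<le> line_prob x - \<alpha>" by (rule Suc)
  finally show ?case .
qed simp

text \<open>
  With \<open>r = min (\<tau> 1) (- \<tau> (-1))\<close>, \<open>\<tau>\<close> maps the open interval from \<open>\<Phi> (-r)\<close> to \<open>\<Phi> r\<close> into
  \<open>(-r, r)\<close>. Its right end is \<open>1\<close> or its left end is \<open>-1\<close>, and \<open>0\<close> lies strictly inside, so its length exceeds
  \<open>1\<close> and it contains a closed interval of length \<open>1\<close>.
\<close>

lemma fundamental_interval:
  "\<exists>a \<rho>. 0 \<le> \<rho> \<and> \<rho> < min (\<tau> 1) (- \<tau> (-1)) \<and> (\<forall>y\<in>{a..a + 1}. \<bar>\<tau> y\<bar> \<le> \<rho>)"
proof -
  define r where "r = min (\<tau> 1) (- \<tau> (-1))"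
  have "0 < \<tau> 1" using tau_less_iff[of 0 1] by simp
  moreover have "\<tau> (-1) < 0" using tau_less_iff[of "-1" 0] by simp
  ultimately have r: "0 < r" by (simp add: r_def)
  have "\<exists>a. - r < \<tau> a \<and> \<tau> (a + 1) < r"
  proof (cases "\<tau> 1 \<le> - \<tau> (-1)")
    case True
    then have "r = \<tau> 1" by (simp add: r_def)
    have neg: "\<Phi> (- r) < 0" using Phi_less_iff[of "- r" 0] r by simp
    have "\<tau> (\<Phi> (- r)) < \<tau> (\<Phi> (- r) / 2)" "\<tau> (\<Phi> (- r) / 2 + 1) < \<tau> 1"
      unfolding tau_less_iff using neg by linarith+
    then show ?thesis unfolding tau_Phi \<open>r = \<tau> 1\<close>[symmetric] by blast
  next
    case False
    then have "- r = \<tau> (-1)" by (simp add: r_def)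
    have pos: "0 < \<Phi> r" using Phi_less_iff[of 0 r] r by simp
    have "\<tau> (-1) < \<tau> (\<Phi> r / 2 - 1)" "\<tau> (\<Phi> r / 2 - 1 + 1) < \<tau> (\<Phi> r)"
      unfolding tau_less_iff using pos by linarith+
    then show ?thesis unfolding tau_Phi \<open>- r = \<tau> (-1)\<close>[symmetric] by blast
  qed
  then obtain a where a: "- r < \<tau> a" "\<tau> (a + 1) < r" by blast
  have "\<tau> a \<le> \<tau> (a + 1)" by simp
  with a have "\<bar>\<tau> a\<bar> < r" "\<bar>\<tau> (a + 1)\<bar> < r" by linarith+
  then have "max \<bar>\<tau> a\<bar> \<bar>\<tau> (a + 1)\<bar> < r" by simp
  moreover have "\<bar>\<tau> y\<bar> \<le> max \<bar>\<tau> a\<bar> \<bar>\<tau> (a + 1)\<bar>" if "y \<in> {a..a + 1}" for y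
  proof -
    have "\<tau> a \<le> \<tau> y" "\<tau> y \<le> \<tau> (a + 1)" using that by simp_all
    then show ?thesis by linarith
  qed
  ultimately show ?thesis unfolding r_def[symmetric]
    by (intro exI[of _ a] exI[of _ "max \<bar>\<tau> a\<bar> \<bar>\<tau> (a + 1)\<bar>"]) auto
qed

text \<open>
  Here \<open>y\<close> is the representative of \<open>x\<close> modulo \<open>1\<close> in the fundamental interval. Its length being
  bounded, one \<open>n\<close> serves all \<open>y\<close> to bring \<open>\<tau>\<^sup>n y\<close> close to \<open>0\<close>, and \<open>\<beta>\<close> is the \<open>n\<close>-th power of the
  minimum of \<open>D\<close> over a compact set where it does not vanish.
\<close>

lemma line_prob_near_1:
  assumes "\<epsilon> > 0"
  shows "\<exists>\<beta>>0. \<forall>x. \<exists>y n. line_prob y = line_prob x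
    \<and> \<beta> \<le> (\<Prod>i<n. D (turn ((\<tau> ^^ Suc i) y))) \<and> 1 - \<epsilon> \<le> line_prob ((\<tau> ^^ n) y)"
proof -
  obtain q where q: "0 < q" "q < 1" "\<And>n x. \<bar>(\<tau> ^^ n) x\<bar> \<le> q ^ n * \<bar>x\<bar>"
    using tau_iter_contracts by blast
  obtain C \<delta> where C: "C > 0" "\<delta> > 0" "\<And>x. \<bar>x\<bar> < \<delta> \<Longrightarrow> exp (- C * \<bar>x\<bar>) \<le> mass x"
    using mass_near_0 by blast
  obtain a \<rho> where a: "0 \<le> \<rho>" "\<rho> < min (\<tau> 1) (- \<tau> (-1))"
    "\<And>y. y \<in> {a..a + 1} \<Longrightarrow> \<bar>\<tau> y\<bar> \<le> \<rho>"
    using fundamental_interval by blast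
  have "continuous_on {- \<rho>..\<rho>} (\<lambda>x. D (turn x))"
    using D_cont by (rule continuous_on_subset) simp
  then obtain t where t: "t \<in> {- \<rho>..\<rho>}" "\<And>x. x \<in> {- \<rho>..\<rho>} \<Longrightarrow> D (turn t) \<le> D (turn x)"
    using continuous_attains_inf[of "{- \<rho>..\<rho>}" "\<lambda>x. D (turn x)"] a(1) by fastforce
  define d where "d = D (turn t)"
  have "d \<noteq> 0" unfolding d_def using t(1) a(2) by (intro D_nonzero) auto
  then have "d > 0" using D_nonneg[of "turn t"] by (simp add: d_def)
  define M where "M = \<bar>a\<bar> + 1"
  have "(\<lambda>n. q ^ n * M) \<longlonglongrightarrow> 0"
    using q by (intro tendsto_mult_left_zero LIMSEQ_power_zero) simp
  moreover have "min \<delta> (\<epsilon> / C) > 0" using C assms by simp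
  ultimately obtain n where n: "q ^ n * M < min \<delta> (\<epsilon> / C)"
    using order_tendstoD(2) eventually_happens'[OF sequentially_bot] by metis
  have "\<exists>y n. line_prob y = line_prob x
    \<and> d ^ n' \<le> (\<Prod>i<n. D (turn ((\<tau> ^^ Suc i) y))) \<and> 1 - \<epsilon> \<le> line_prob ((\<tau> ^^ n) y)"
    if "n' = n" for x n'
  proof (intro exI conjI)
    define y where "y = x + of_int (- \<lfloor>x - a\<rfloor>)"
    have y: "y \<in> {a..a + 1}" unfolding y_def by simp linarith
    show "line_prob y = line_prob x" unfolding y_def by (rule line_prob_add_int)
    have "d \<le> D (turn ((\<tau> ^^ Suc i) y))" for i
    proof -
      have "\<bar>(\<tau> ^^ i) (\<tau> y)\<bar> \<le> q ^ i * \<bar>\<tau> y\<bar>" by (rule q(3))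
      also have "\<dots> \<le> 1 * \<bar>\<tau> y\<bar>" using q by (intro mult_right_mono power_le_one) auto
      also have "\<dots> \<le> \<rho>" using a(3)[OF y] by simp
      finally have "\<bar>(\<tau> ^^ Suc i) y\<bar> \<le> \<rho>"
        by (simp only: funpow_Suc_right o_apply)
      then show ?thesis unfolding d_def by (intro t(2)) auto
    qed
    then have "(\<Prod>i<n. d) \<le> (\<Prod>i<n. D (turn ((\<tau> ^^ Suc i) y)))"
      using \<open>d > 0\<close> by (intro prod_mono) auto
    then show "d ^ n' \<le> (\<Prod>i<n. D (turn ((\<tau> ^^ Suc i) y)))" using that by simp
    have "\<bar>y\<bar> \<le> M" using y by (auto simp: M_def)
    then have "q ^ n * \<bar>y\<bar> \<le> q ^ n * M" using q by (intro mult_left_mono) auto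
    then have small: "\<bar>(\<tau> ^^ n) y\<bar> < \<delta>" "\<bar>(\<tau> ^^ n) y\<bar> < \<epsilon> / C"
      using q(3)[of n y] n by auto
    have "1 - \<epsilon> \<le> 1 + (- C * \<bar>(\<tau> ^^ n) y\<bar>)"
      using small(2) C(1) by (simp add: field_simps)
    also have "\<dots> \<le> exp (- C * \<bar>(\<tau> ^^ n) y\<bar>)" by (rule exp_ge_add_one_self)
    also have "\<dots> \<le> mass ((\<tau> ^^ n) y)" by (rule C(3)[OF small(1)])
    also have "\<dots> \<le> line_prob ((\<tau> ^^ n) y)" by (rule mass_le_line_prob)
    finally show "1 - \<epsilon> \<le> line_prob ((\<tau> ^^ n) y)" .
  qed
  then show ?thesis using \<open>d > 0\<close> by (intro exI[of _ "d ^ n"]) auto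
qed

text \<open>
  If the infimum \<open>\<alpha>\<close> were below \<open>1 - \<epsilon>\<close>, the last two estimates would raise every value of
  \<open>line_prob\<close> to at least \<open>\<alpha> + \<beta> (1 - \<epsilon> - \<alpha>)\<close>, which is strictly more than \<open>\<alpha>\<close>.
\<close>

lemma line_prob_1: "line_prob x = 1"
proof -
  define \<alpha> where "\<alpha> = (INF x. line_prob x)"
  have bdd: "bdd_below (range line_prob)"
    using line_prob_bounds(1) by (intro bdd_belowI[of _ 0]) auto
  have le: "\<alpha> \<le> line_prob x" for x
    unfolding \<alpha>_def by (rule cINF_lower[OF bdd UNIV_I])
  have near: "1 - \<epsilon> \<le> \<alpha>" if "\<epsilon> > 0" for \<epsilon>
  proof (rule ccontr)
    assume *: "\<not> 1 - \<epsilon> \<le> \<alpha>"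
    obtain \<beta> where \<beta>: "\<beta> > 0" and ex: "\<And>x. \<exists>y n. line_prob y = line_prob x
      \<and> \<beta> \<le> (\<Prod>i<n. D (turn ((\<tau> ^^ Suc i) y))) \<and> 1 - \<epsilon> \<le> line_prob ((\<tau> ^^ n) y)"
      using line_prob_near_1[OF \<open>\<epsilon> > 0\<close>] by blast
    have "\<alpha> + \<beta> * (1 - \<epsilon> - \<alpha>) \<le> line_prob x" for x
    proof -
      obtain y n where y: "line_prob y = line_prob x"
        "\<beta> \<le> (\<Prod>i<n. D (turn ((\<tau> ^^ Suc i) y)))" "1 - \<epsilon> \<le> line_prob ((\<tau> ^^ n) y)"
        using ex by blast
      have "\<beta> * (1 - \<epsilon> - \<alpha>) \<le> (\<Prod>i<n. D (turn ((\<tau> ^^ Suc i) y))) * (line_prob ((\<tau> ^^ n) y) - \<alpha>)"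
        using y(2,3) \<beta> * by (intro mult_mono) auto
      also have "\<dots> \<le> line_prob y - \<alpha>" by (rule line_prob_lower[OF le])
      finally show ?thesis using y(1) by simp
    qed
    then have "\<alpha> + \<beta> * (1 - \<epsilon> - \<alpha>) \<le> \<alpha>"
      unfolding \<alpha>_def by (intro cINF_greatest) auto
    moreover have "0 < \<beta> * (1 - \<epsilon> - \<alpha>)" using \<beta> * by (intro mult_pos_pos) auto
    ultimately show False by simp
  qed
  have "1 \<le> \<alpha>"
  proof (rule field_le_epsilon)
    fix e :: real assume "0 < e"
    then show "1 \<le> \<alpha> + e" using near[of e] by linarith
  qed
  then show ?thesis using le[of x] line_prob_bounds(2)[of x] by linarith
qed

end

section \<open>The measure on the solenoid as an image of the line\<close>

context weighted_solenoid
begin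

abbreviation "solenoid_borel \<equiv> restrict_space borel (solenoid \<sigma>) :: (nat \<Rightarrow> complex) measure"

lemma emeasure_nu:
  assumes A: "A \<in> sets solenoid_borel"
  shows "emeasure (\<nu> (turn x)) A
    = (\<integral>\<^sup>+k. ennreal (mass (x + of_int k)) * indicator A (line_path (x + of_int k))
        \<partial>count_space (UNIV::int set))"
proof -
  interpret prob_space "\<nu> (turn x)" by (rule prob_nu)
  have "prob (fibre_lines x) = 1" using line_prob_1[of x] by (simp add: line_prob_def)
  then have "AE w in \<nu> (turn x). w \<in> fibre_lines x" by (rule AE_prob_1)
  then have "emeasure (\<nu> (turn x)) A = emeasure (\<nu> (turn x)) (A \<inter> fibre_lines x)"
    using A emeasure_fibre_lines(1)[where A = A and x = x]
    by (intro emeasure_eq_AE) (auto simp: sets_nu elim!: eventually_mono)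
  then show ?thesis using emeasure_fibre_lines(2)[where A = A and x = x] by simp
qed

lemma space_circle_measure: "space circle_measure = circle"
  by (simp add: circle_measure_def space_restrict_space)

lemma indicator_line_path_measurable:
  "A \<in> sets solenoid_borel \<Longrightarrow> (\<lambda>x. indicator A (line_path x) :: ennreal) \<in> borel_measurable borel"
  by (rule measurable_compose[OF line_path_measurable borel_measurable_indicator])

text \<open>
  The explicit sum shows that the path measures depend measurably on the base point. Without this
  the monadic integral of \<open>\<nu>\<close> over the circle would not be the mixture of the \<open>\<nu>\<^sub>z\<close>. The integers
  are enumerated in order to use measurability of countable series.
\<close>

lemma emeasure_nu_measurable:
  assumes A: "A \<in> sets solenoid_borel"
  shows "(\<lambda>z. emeasure (\<nu> z) A) \<in> borel_measurable (restrict_space borel circle)"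
proof -
  note [measurable] = indicator_line_path_measurable[OF A]
  let ?G = "\<lambda>x. \<Sum>n. ennreal (mass (x + of_int (int_decode n)))
    * indicator A (line_path (x + of_int (int_decode n)))"
  have "emeasure (\<nu> z) A = ?G (angle z)" if "z \<in> circle" for z
  proof -
    have "emeasure (\<nu> z) A = emeasure (\<nu> (turn (angle z))) A" by (simp only: turn_angle[OF that])
    also have "\<dots> = ?G (angle z)"
      unfolding emeasure_nu[OF A]
      by (subst nn_integral_bij_count_space[OF bij_int_decode, symmetric])
         (simp add: nn_integral_count_space_nat)
    finally show ?thesis .
  qed
  moreover have "(\<lambda>z. ?G (angle z)) \<in> borel_measurable (restrict_space borel circle)"
  proof (rule measurable_compose[OF measurable_restrict_space1[OF measurable_angle]])
    have shift: "(\<lambda>x. x + real_of_int (int_decode n)) \<in> borel_measurable borel" for n by measurable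
    have "(\<lambda>x. ennreal (mass (x + of_int (int_decode n)))
        * indicator A (line_path (x + of_int (int_decode n)))) \<in> borel_measurable borel" for n
      by (rule measurable_compose[OF shift, of "\<lambda>x. ennreal (mass x) * indicator A (line_path x)"])
         measurable
    then show "?G \<in> borel_measurable borel" by (intro borel_measurable_suminf_order)
  qed
  ultimately show ?thesis
    by (subst measurable_cong[where g = "\<lambda>z. ?G (angle z)"]) (simp_all add: space_restrict_space)
qed

lemma nu_kernel: "\<nu> \<in> circle_measure \<rightarrow>\<^sub>M subprob_algebra solenoid_borel"
proof (rule measurable_subprob_algebra)
  fix z assume "z \<in> space circle_measure"
  then have "z \<in> circle" by (simp add: space_circle_measure)
  then have P: "is_path_measure \<sigma> D z (\<nu> z)" by (rule path)
  then show "subprob_space (\<nu> z)" "sets (\<nu> z) = sets solenoid_borel"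
    by (simp_all add: is_path_measure_def prob_space_imp_subprob_space)
next
  fix A assume "A \<in> sets solenoid_borel"
  then show "(\<lambda>z. emeasure (\<nu> z) A) \<in> borel_measurable circle_measure"
    using emeasure_nu_measurable
    by (simp add: circle_measure_def)
qed

definition \<mu>_sol :: "(nat \<Rightarrow> complex) measure" where
  "\<mu>_sol = circle_measure \<bind> \<nu>"

lemma sets_mu_sol: "sets \<mu>_sol = sets solenoid_borel"
  unfolding \<mu>_sol_def by (rule sets_bind[OF sets_kernel[OF nu_kernel]])
    (auto simp: space_circle_measure intro!: exI[of _ 1])

lemma space_mu_sol: "space \<mu>_sol = solenoid \<sigma>"
  using sets_eq_imp_space_eq[OF sets_mu_sol] by (simp add: space_restrict_space)

lemma measurable_mu_sol: "f \<in> borel_measurable solenoid_borel \<Longrightarrow> f \<in> borel_measurable \<mu>_sol"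
  using measurable_cong_sets[OF sets_mu_sol refl] by blast

text \<open>
  Summing the masses over the fibre and integrating over \<open>[0, 1)\<close> is integration over the line.
\<close>

lemma emeasure_mu_sol:
  assumes A: "A \<in> sets solenoid_borel"
  shows "emeasure \<mu>_sol A = (\<integral>\<^sup>+x. ennreal (mass x) * indicator A (line_path x) \<partial>lborel)"
proof -
  note [measurable] = indicator_line_path_measurable[OF A] emeasure_nu_measurable[OF A]
  have turn: "turn \<in> restrict_space lborel {0..<1} \<rightarrow>\<^sub>M restrict_space borel circle"
    by (intro measurable_restrict_space2 measurable_restrict_space1) auto
  have "emeasure \<mu>_sol A = (\<integral>\<^sup>+z. emeasure (\<nu> z) A \<partial>circle_measure)"
    unfolding \<mu>_sol_def using nu_kernel A
    by (intro emeasure_bind) (auto simp: space_circle_measure intro!: exI[of _ 1])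
  also have "\<dots> = (\<integral>\<^sup>+t. emeasure (\<nu> (turn t)) A \<partial>restrict_space lborel {0..<1})"
    unfolding circle_measure_def by (rule nn_integral_distr[OF turn]) simp
  also have "\<dots> = (\<integral>\<^sup>+t. emeasure (\<nu> (turn t)) A * indicator {0..<1::real} t \<partial>lborel)"
    by (rule nn_integral_restrict_space) simp
  also have "\<dots> = (\<integral>\<^sup>+x. ennreal (mass x) * indicator A (line_path x) \<partial>lborel)"
    unfolding emeasure_nu[OF A]
    by (rule nn_integral_lborel_unit_intervals[symmetric]) measurable
  finally show ?thesis .
qed

lemma prob_space_mu_sol: "prob_space \<mu>_sol"
proof
  have "emeasure \<mu>_sol (space \<mu>_sol)
      = (\<integral>\<^sup>+t. (\<integral>\<^sup>+k. ennreal (mass (t + of_int k)) \<partial>count_space (UNIV::int set))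
          * indicator {0..<1::real} t \<partial>lborel)"
    using emeasure_mu_sol[of "solenoid \<sigma>"] line_path_solenoid
      sets.top[of solenoid_borel]
    by (simp add: space_mu_sol space_restrict_space nn_integral_lborel_unit_intervals)
  then show "emeasure \<mu>_sol (space \<mu>_sol) = 1"
    by (simp add: line_prob_eq[symmetric] line_prob_1)
qed

lemma transports_line_path:
  assumes [measurable]: "F \<in> borel_measurable borel"
    and F: "\<And>x. x \<noteq> 0 \<Longrightarrow> (cmod (F x))\<^sup>2 = mass x"
  shows "transports \<mu>_sol lborel F line_path"
proof (rule transportsI)
  show "line_path \<in> lborel \<rightarrow>\<^sub>M \<mu>_sol"
    using line_path_measurable measurable_cong_sets[OF sets_lborel sets_mu_sol] by blast
  fix A assume "A \<in> sets \<mu>_sol"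
  then have "emeasure \<mu>_sol A = (\<integral>\<^sup>+x. ennreal (mass x) * indicator A (line_path x) \<partial>lborel)"
    by (intro emeasure_mu_sol) (simp add: sets_mu_sol)
  also have "\<dots> = (\<integral>\<^sup>+x. ennreal ((cmod (F x))\<^sup>2) * indicator A (line_path x) \<partial>lborel)"
    using AE_lborel_singleton[of 0] by (intro nn_integral_cong_AE) (auto simp: F elim!: eventually_mono)
  finally show "emeasure \<mu>_sol A
      = (\<integral>\<^sup>+x. ennreal ((cmod (F x))\<^sup>2) * indicator A (line_path x) \<partial>lborel)" .
qed simp

lemma solenoid_map_measurable: "solenoid_map \<sigma> \<in> \<mu>_sol \<rightarrow>\<^sub>M \<mu>_sol"
proof -
  have sig: "\<sigma> z = turn (\<Phi> (angle z))" if "z \<in> circle" for z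
    using sigma_turn[of "angle z"] turn_angle[OF that] by simp
  have "solenoid_map \<sigma> \<in> solenoid_borel \<rightarrow>\<^sub>M solenoid_borel"
  proof (rule measurable_into_solenoid)
    fix \<zeta> assume "\<zeta> \<in> space solenoid_borel"
    then have \<zeta>: "\<zeta> \<in> solenoid \<sigma>" by (simp add: space_restrict_space)
    then have "\<sigma> (\<zeta> 0) \<in> circle" using sig[of "\<zeta> 0"] by (simp add: solenoid_def)
    then show "solenoid_map \<sigma> \<zeta> \<in> solenoid \<sigma>"
      using \<zeta> by (auto simp: solenoid_def solenoid_map_def split: nat.split)
  next
    fix n show "(\<lambda>\<zeta>. solenoid_map \<sigma> \<zeta> n) \<in> borel_measurable solenoid_borel"
    proof (cases n)
      case 0
      have "(\<lambda>\<zeta>. turn (\<Phi> (angle (\<zeta> 0)))) \<in> borel_measurable solenoid_borel"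
        by (intro measurable_compose[OF measurable_coordinate] measurable_compose[OF measurable_angle]
            measurable_compose[OF Phi_measurable] measurable_turn)
      then show ?thesis
        by (rule subst[OF measurable_cong, rotated])
           (auto simp: 0 solenoid_map_def space_restrict_space sig solenoid_def)
    next
      case (Suc k)
      then show ?thesis using measurable_coordinate by (simp add: solenoid_map_def)
    qed
  qed
  then show ?thesis using measurable_cong_sets[OF sets_mu_sol sets_mu_sol] by blast
qed

text \<open>
  Pulled back to the line, the claim is that the density \<open>P\<close> transforms under \<open>\<Phi>\<close> by the factor
  \<open>D\<close> while Lebesgue measure contributes \<open>\<phi>\<close>, and \<open>|m|\<^sup>2 = \<phi> D\<close>.
\<close>

lemma transports_solenoid_map:
  assumes m_cont: "continuous_on circle m"
    and m: "\<And>x. (cmod (m (turn x)))\<^sup>2 = \<phi> x * D (turn x)"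
  shows "transports \<mu>_sol \<mu>_sol (\<lambda>\<zeta>. m (solenoid_proj \<zeta>)) (solenoid_map \<sigma>)"
proof (rule transportsI)
  have "(\<lambda>\<zeta>. \<zeta> 0) \<in> solenoid_borel \<rightarrow>\<^sub>M restrict_space borel circle"
    by (intro measurable_restrict_space2 measurable_coordinate)
       (auto simp: space_restrict_space solenoid_def)
  then have "(\<lambda>\<zeta>. m (\<zeta> 0)) \<in> borel_measurable solenoid_borel"
    using borel_measurable_continuous_on_restrict[OF m_cont] by (rule measurable_compose)
  then show m_meas: "(\<lambda>\<zeta>. m (solenoid_proj \<zeta>)) \<in> borel_measurable \<mu>_sol"
    unfolding solenoid_proj_def by (rule measurable_mu_sol)
  show sm: "solenoid_map \<sigma> \<in> \<mu>_sol \<rightarrow>\<^sub>M \<mu>_sol" by (rule solenoid_map_measurable)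
  fix A assume A: "A \<in> sets \<mu>_sol"
  then have A': "A \<in> sets solenoid_borel" by (simp add: sets_mu_sol)
  note [measurable] = indicator_line_path_measurable[OF A']
  let ?F = "\<lambda>x. complex_of_real (sqrt (mass x))"
  have tr: "transports \<mu>_sol lborel ?F line_path"
    by (rule transports_line_path) (auto simp: mass_nonneg)
  have "emeasure \<mu>_sol A = (\<integral>\<^sup>+x. ennreal (mass x) * indicator A (line_path x) \<partial>lborel)"
    by (rule emeasure_mu_sol[OF A'])
  also have "\<dots> = (\<integral>\<^sup>+x. ennreal ((cmod (complex_of_real (sqrt (\<phi> x))))\<^sup>2)
      * (ennreal (mass (\<Phi> x)) * indicator A (line_path (\<Phi> x))) \<partial>lborel)"
    by (rule transports_nn_integral[OF transports_Phi]) measurable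
  also have "\<dots> = (\<integral>\<^sup>+x. ennreal ((cmod (?F x))\<^sup>2) * (ennreal ((cmod (m (solenoid_proj (line_path x))))\<^sup>2)
      * indicator A (solenoid_map \<sigma> (line_path x))) \<partial>lborel)"
  proof (rule nn_integral_cong)
    fix x
    have "0 \<le> \<phi> x" using gt_1[of x] by linarith
    then show "ennreal ((cmod (complex_of_real (sqrt (\<phi> x))))\<^sup>2)
        * (ennreal (mass (\<Phi> x)) * indicator A (line_path (\<Phi> x)))
      = ennreal ((cmod (?F x))\<^sup>2) * (ennreal ((cmod (m (solenoid_proj (line_path x))))\<^sup>2)
        * indicator A (solenoid_map \<sigma> (line_path x)))"
      unfolding solenoid_proj_def line_path_0 m mass_Phi solenoid_map_line_path
      by (simp add: mass_nonneg D_nonneg ennreal_mult mult_ac)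
  qed
  also have "\<dots> = (\<integral>\<^sup>+\<zeta>. ennreal ((cmod (m (solenoid_proj \<zeta>)))\<^sup>2) * indicator A (solenoid_map \<sigma> \<zeta>) \<partial>\<mu>_sol)"
  proof (rule transports_nn_integral[OF tr, symmetric])
    note [measurable] = m_meas sm A
    show "(\<lambda>\<zeta>. ennreal ((cmod (m (solenoid_proj \<zeta>)))\<^sup>2) * indicator A (solenoid_map \<sigma> \<zeta>))
        \<in> borel_measurable \<mu>_sol" by measurable
  qed
  finally show "emeasure \<mu>_sol A
      = (\<integral>\<^sup>+\<zeta>. ennreal ((cmod (m (solenoid_proj \<zeta>)))\<^sup>2) * indicator A (solenoid_map \<sigma> \<zeta>) \<partial>\<mu>_sol)" .
qed

text \<open>
  \<open>\<Phi>\<close> and \<open>\<tau>\<close> preserve null sets, so almost no \<open>x\<close> has a vanishing factor.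
\<close>

lemma mass_pos_AE:
  assumes "AE x in lborel. D (turn x) \<noteq> 0"
  shows "AE x in lborel. 0 < mass x"
proof -
  have "AE x in lborel. D (turn ((\<tau> ^^ n) x)) \<noteq> 0" for n
  proof (induction n)
    case (Suc n)
    show ?case
    proof (rule transports_AE_converse[OF transports_Phi])
      have shift: "(\<tau> ^^ Suc n) (\<Phi> x) = (\<tau> ^^ n) x" for x
        by (simp only: funpow_Suc_right o_apply tau_Phi)
      show "AE x in lborel. D (turn ((\<tau> ^^ Suc n) (\<Phi> x))) \<noteq> 0"
        using Suc by (simp only: shift)
      have "(\<lambda>x. D (turn ((\<tau> ^^ Suc n) x))) \<in> borel_measurable borel"
        using measurable_compose[OF tau_iter_measurable D_turn_measurable] .
      note [measurable] = this
      show "Measurable.pred lborel (\<lambda>x. D (turn ((\<tau> ^^ Suc n) x)) \<noteq> 0)"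
        by measurable
    qed
  qed (use assms in simp)
  then have "AE x in lborel. \<forall>n. D (turn ((\<tau> ^^ n) x)) \<noteq> 0"
    unfolding AE_all_countable by blast
  then show ?thesis by (rule AE_mp) (auto intro!: AE_I2 mass_pos simp del: funpow.simps)
qed

text \<open>
  \<open>D \<circ> e\<close> is periodic, and since the masses over a fibre add up to \<open>1\<close>, every \<open>x\<close> has an integer
  translate of positive mass, where the assumption applies.
\<close>

lemma D_nonzero_AE:
  assumes "AE x in lborel. mass x \<noteq> 0 \<longrightarrow> D (turn x) \<noteq> 0"
  shows "AE x in lborel. D (turn x) \<noteq> 0"
proof -
  have "AE x in lborel. mass (of_int k + 1 * x) \<noteq> 0 \<longrightarrow> D (turn (of_int k + 1 * x)) \<noteq> 0" for k :: int
    using assms by (intro AE_borel_affine[where P = "\<lambda>x. mass x \<noteq> 0 \<longrightarrow> D (turn x) \<noteq> 0"]) simp_all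
  then have "AE x in lborel. \<forall>k::int. mass (x + of_int k) \<noteq> 0 \<longrightarrow> D (turn x) \<noteq> 0"
    unfolding AE_all_countable by (simp add: add.commute[of "real_of_int _"])
  then show ?thesis
  proof eventually_elim
    case (elim x)
    have "\<exists>k::int. mass (x + of_int k) \<noteq> 0"
    proof (rule ccontr)
      assume "\<nexists>k::int. mass (x + of_int k) \<noteq> 0"
      then have "ennreal (line_prob x) = 0" unfolding line_prob_eq by simp
      then show False by (simp add: line_prob_1)
    qed
    with elim show ?case by blast
  qed
qed

end

section \<open>Unimodular cocycles over the lift\<close>

lemma prod_lessThan_tendsto_of_eventually_1:
  fixes c :: "nat \<Rightarrow> 'a :: {comm_monoid_mult, topological_space}"
  assumes "\<And>i. M \<le> i \<Longrightarrow> c i = 1"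
  shows "(\<lambda>n. \<Prod>i<n. c i) \<longlonglongrightarrow> (\<Prod>i<M. c i)"
proof (rule tendsto_eventually)
  have "(\<Prod>i<n. c i) = (\<Prod>i<M. c i)" if "M \<le> n" for n
    using that assms by (intro prod.mono_neutral_right) auto
  then show "\<forall>\<^sub>F n in sequentially. (\<Prod>i<n. c i) = (\<Prod>i<M. c i)"
    by (rule eventually_sequentiallyI)
qed

context expanding_lift
begin

text \<open>
  The infinite product of the \<open>s (\<tau>\<^sup>i x)\<close> need not converge, as nothing controls \<open>s\<close> near
  \<open>0\<close>. Instead \<open>s x = f x \<cdot> g (\<Phi> x)\<close> is split into a factor that is trivial unless
  \<open>\<Phi> x\<close> lies in \<open>(-1, 1)\<close> and one that is trivial when it does. Along a backward orbit \<open>g\<close> is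
  eventually \<open>1\<close>, and along a forward orbit of \<open>x \<noteq> 0\<close> so is \<open>f\<close>, so the products
  \<open>A x = \<Prod>\<^sub>i g (\<tau>\<^sup>i x)\<close> and \<open>B x = \<Prod>\<^sub>i f (\<Phi>\<^sup>i x)\<close> are finite. The quotient \<open>\<theta> = A / B\<close> solves
  the equation.
\<close>

lemma unimodular_cocycle_trivial:
  fixes s :: "real \<Rightarrow> complex"
  assumes s [measurable]: "s \<in> borel_measurable borel" and s_norm: "\<And>x. cmod (s x) = 1"
  obtains \<theta> where "\<theta> \<in> borel_measurable borel" "\<And>x. x \<noteq> 0 \<Longrightarrow> cmod (\<theta> x) = 1"
    "\<And>x. x \<noteq> 0 \<Longrightarrow> \<theta> (\<Phi> x) = s x * \<theta> x"
proof -
  define g where "g y = (if \<bar>y\<bar> < 1 then 1 else s (\<tau> y))" for y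
  define f where "f y = (if \<bar>\<Phi> y\<bar> < 1 then s y else 1)" for y
  define A where "A x = lim (\<lambda>n. \<Prod>i<n. g ((\<tau> ^^ i) x))" for x
  define B where "B x = lim (\<lambda>n. \<Prod>i<n. f ((\<Phi> ^^ i) x))" for x
  have [measurable]: "g \<in> borel_measurable borel" "f \<in> borel_measurable borel"
    unfolding g_def f_def by measurable
  have norm_gf: "cmod (g y) = 1" "cmod (f y) = 1" for y by (simp_all add: g_def f_def s_norm)
  obtain q where q: "0 < q" "q < 1" "\<And>n x. \<bar>(\<tau> ^^ n) x\<bar> \<le> q ^ n * \<bar>x\<bar>"
    using tau_iter_contracts by blast
  have A: "(\<lambda>n. \<Prod>i<n. g ((\<tau> ^^ i) x)) \<longlonglongrightarrow> A x" "cmod (A x) = 1" for x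
  proof -
    obtain M where "\<And>i. i \<ge> M \<Longrightarrow> \<bar>(\<tau> ^^ i) x\<bar> < 1"
      using tendstoD[OF tau_iter_tendsto_0, of 1 x]
      by (auto simp: dist_real_def eventually_sequentially)
    then have lim: "(\<lambda>n. \<Prod>i<n. g ((\<tau> ^^ i) x)) \<longlonglongrightarrow> (\<Prod>i<M. g ((\<tau> ^^ i) x))"
      by (intro prod_lessThan_tendsto_of_eventually_1) (simp add: g_def)
    then have "A x = (\<Prod>i<M. g ((\<tau> ^^ i) x))" unfolding A_def by (rule limI)
    with lim show "(\<lambda>n. \<Prod>i<n. g ((\<tau> ^^ i) x)) \<longlonglongrightarrow> A x" "cmod (A x) = 1"
      by (simp_all add: prod_norm[symmetric] norm_gf)
  qed
  have B: "(\<lambda>n. \<Prod>i<n. f ((\<Phi> ^^ i) x)) \<longlonglongrightarrow> B x" "cmod (B x) = 1" if nz: "x \<noteq> 0" for x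
  proof -
    have "(\<lambda>n. q ^ n) \<longlonglongrightarrow> 0" using q by (intro LIMSEQ_power_zero) simp
    then obtain M where M: "\<And>i. i \<ge> M \<Longrightarrow> q ^ i < \<bar>x\<bar>"
      using order_tendstoD(2)[of "\<lambda>n. q ^ n" 0 sequentially "\<bar>x\<bar>"] nz
      by (auto simp: eventually_sequentially)
    have "\<not> \<bar>\<Phi> ((\<Phi> ^^ i) x)\<bar> < 1" if "M \<le> i" for i
    proof
      assume "\<bar>\<Phi> ((\<Phi> ^^ i) x)\<bar> < 1"
      then have "q ^ Suc i * \<bar>(\<Phi> ^^ Suc i) x\<bar> \<le> q ^ Suc i * 1"
        using q by (intro mult_left_mono) auto
      moreover have "\<bar>x\<bar> \<le> q ^ Suc i * \<bar>(\<Phi> ^^ Suc i) x\<bar>"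
        using q(3)[of "Suc i" "(\<Phi> ^^ Suc i) x"] by (simp only: tau_iter_Phi_iter)
      ultimately show False using M[of "Suc i"] that by auto
    qed
    then have lim: "(\<lambda>n. \<Prod>i<n. f ((\<Phi> ^^ i) x)) \<longlonglongrightarrow> (\<Prod>i<M. f ((\<Phi> ^^ i) x))"
      by (intro prod_lessThan_tendsto_of_eventually_1) (simp add: f_def)
    then have "B x = (\<Prod>i<M. f ((\<Phi> ^^ i) x))" unfolding B_def by (rule limI)
    with lim show "(\<lambda>n. \<Prod>i<n. f ((\<Phi> ^^ i) x)) \<longlonglongrightarrow> B x" "cmod (B x) = 1"
      by (simp_all add: prod_norm[symmetric] norm_gf)
  qed
  have A_Phi: "A (\<Phi> x) = g (\<Phi> x) * A x" for x
  proof -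
    have shift: "(\<tau> ^^ Suc i) (\<Phi> x) = (\<tau> ^^ i) x" for i
      by (simp only: funpow_Suc_right o_apply tau_Phi)
    have "(\<lambda>n. \<Prod>i<Suc n. g ((\<tau> ^^ i) (\<Phi> x))) \<longlonglongrightarrow> A (\<Phi> x)"
      by (rule LIMSEQ_Suc[OF A(1)])
    also have "(\<lambda>n. \<Prod>i<Suc n. g ((\<tau> ^^ i) (\<Phi> x))) = (\<lambda>n. g (\<Phi> x) * (\<Prod>i<n. g ((\<tau> ^^ i) x)))"
      unfolding prod.lessThan_Suc_shift shift by simp
    finally have "(\<lambda>n. g (\<Phi> x) * (\<Prod>i<n. g ((\<tau> ^^ i) x))) \<longlonglongrightarrow> A (\<Phi> x)" .
    moreover have "(\<lambda>n. g (\<Phi> x) * (\<Prod>i<n. g ((\<tau> ^^ i) x))) \<longlonglongrightarrow> g (\<Phi> x) * A x"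
      by (rule tendsto_mult_left[OF A(1)])
    ultimately show ?thesis by (intro LIMSEQ_unique)
  qed
  have B_Phi: "B x = f x * B (\<Phi> x)" if x: "x \<noteq> 0" for x
  proof -
    have x': "\<Phi> x \<noteq> 0" using x Phi_eq_iff[of x 0] by simp
    have shift: "(\<Phi> ^^ Suc i) x = (\<Phi> ^^ i) (\<Phi> x)" for i
      by (simp only: funpow_Suc_right o_apply)
    have "(\<lambda>n. \<Prod>i<Suc n. f ((\<Phi> ^^ i) x)) \<longlonglongrightarrow> B x"
      by (rule LIMSEQ_Suc[OF B(1)[OF x]])
    also have "(\<lambda>n. \<Prod>i<Suc n. f ((\<Phi> ^^ i) x)) = (\<lambda>n. f x * (\<Prod>i<n. f ((\<Phi> ^^ i) (\<Phi> x))))"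
      unfolding prod.lessThan_Suc_shift shift by simp
    finally have "(\<lambda>n. f x * (\<Prod>i<n. f ((\<Phi> ^^ i) (\<Phi> x)))) \<longlonglongrightarrow> B x" .
    moreover have "(\<lambda>n. f x * (\<Prod>i<n. f ((\<Phi> ^^ i) (\<Phi> x)))) \<longlonglongrightarrow> f x * B (\<Phi> x)"
      by (rule tendsto_mult_left[OF B(1)[OF x']])
    ultimately show ?thesis by (intro LIMSEQ_unique)
  qed
  show thesis
  proof (rule that[of "\<lambda>x. A x / B x"])
    have "(\<lambda>x. \<Prod>i<n. g ((\<tau> ^^ i) x)) \<in> borel_measurable borel"
      "(\<lambda>x. \<Prod>i<n. f ((\<Phi> ^^ i) x)) \<in> borel_measurable borel" for n
      by (intro borel_measurable_prod measurable_compose[OF tau_iter_measurable]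
          measurable_compose[OF Phi_iter_measurable]; measurable)+
    then have "A \<in> borel_measurable borel" "B \<in> borel_measurable borel"
      unfolding A_def[abs_def] B_def[abs_def] by (intro borel_measurable_lim_metric; simp)+
    then show "(\<lambda>x. A x / B x) \<in> borel_measurable borel"
      by (rule borel_measurable_divide)
    show "cmod (A x / B x) = 1" if "x \<noteq> 0" for x
      using A(2) B(2)[OF that] by (simp add: norm_divide)
    show "A (\<Phi> x) / B (\<Phi> x) = s x * (A x / B x)" if x: "x \<noteq> 0" for x
    proof -
      have "s x = f x * g (\<Phi> x)" by (simp add: g_def f_def)
      moreover have "f x \<noteq> 0" using norm_gf(2)[of x] by auto
      ultimately show ?thesis by (simp add: A_Phi B_Phi[OF x])
    qed
  qed
qed

end

section \<open>The intertwining isomorphism\<close>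

theorem theorem13p7p1:
  fixes \<phi> :: "real \<Rightarrow> real"
    and N :: nat
    and \<sigma> m u :: "complex \<Rightarrow> complex"
    and \<psi> D :: "complex \<Rightarrow> real"
    and rk :: "nat \<Rightarrow> real"
    and r :: real
    and \<nu> :: "complex \<Rightarrow> (nat \<Rightarrow> complex) measure"
    and \<mu>_inf :: "(nat \<Rightarrow> complex) measure"
  assumes phi_cont: "continuous_on UNIV \<phi>"
    and phi_pos: "\<And>x. \<phi> x > 0"
    and phi_periodic: "\<And>x. \<phi> (x + 1) = \<phi> x"
    and phi_integral: "primitive \<phi> 1 = real N"
    and N_ge_2: "N \<ge> 2"
    and phi_gt_1: "\<And>x. \<phi> x > 1"
    and sigma: "\<And>x. \<sigma> (cis (2 * pi * x)) = cis (2 * pi * primitive \<phi> x)"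
    and psi: "\<And>x. \<psi> (cis (2 * pi * x)) = 1 / \<phi> x"
    and psi_sum: "\<And>z. z \<in> circle \<Longrightarrow> (\<Sum>w\<in>preimages \<sigma> z. \<psi> w) = 1"
    and filter: "psi_filter \<sigma> \<psi> m"
    and u: "\<And>x. u (cis (2 * pi * x)) = m (cis (2 * pi * x)) / complex_of_real (sqrt (\<phi> x))"
    and D: "\<And>w. D w = (cmod (u w))\<^sup>2"
    and rk: "\<And>k. k \<in> {1..N - 1} \<Longrightarrow> rk k \<in> {0..<1} \<and> primitive \<phi> (rk k) = real k"
    and r: "r = min (rk 1) (1 - rk (N - 1))"
    and u_one: "cmod (u 1) = 1"
    and u_nonzero: "\<And>x. \<bar>x\<bar> < r \<Longrightarrow> u (cis (2 * pi * x)) \<noteq> 0"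
    and u_log: "(\<lambda>x::real. ln ((cmod (u (cis (2 * pi * x))))\<^sup>2)) \<in> O[at 0](\<lambda>x. x)"
    and nu: "\<And>z. z \<in> circle \<Longrightarrow> is_path_measure \<sigma> D z (\<nu> z)"
    and mu_inf: "\<mu>_inf = circle_measure \<bind> \<nu>"
    and U_tilde_unitary: "L2_unitary \<mu>_inf (U_tilde \<mu>_inf \<sigma> m)"
  shows "L2_unitary lborel (U_line \<phi>) \<and>
    (\<exists>R. L2_isometric_iso \<mu>_inf lborel R \<and>
         (\<forall>A\<in>L2 \<mu>_inf. R (U_tilde \<mu>_inf \<sigma> m A) = U_line \<phi> (R A)))"
proof -
  have m_cont: "continuous_on circle m" using filter by (simp add: psi_filter_def)
  have m_sq: "(cmod (m (turn x)))\<^sup>2 = \<phi> x * D (turn x)" for x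
    using phi_pos[of x] by (simp add: D u norm_divide power_divide)
  have D_psi: "D w = \<psi> w * (cmod (m w))\<^sup>2" if "w \<in> circle" for w
  proof -
    have "D (turn (angle w)) = \<psi> (turn (angle w)) * (cmod (m (turn (angle w))))\<^sup>2"
      using phi_pos[of "angle w"] unfolding psi m_sq by simp
    then show ?thesis by (simp only: turn_angle[OF that])
  qed
  interpret L: expanding_lift \<phi> N
    using phi_cont phi_periodic phi_integral phi_gt_1 by unfold_locales
  have N1: "1 \<in> {1..N - 1}" "N - 1 \<in> {1..N - 1}" using N_ge_2 by auto
  have "rk 1 = L.\<tau> 1"
    using rk[OF N1(1)] L.tau_Phi[of "rk 1"] by simp
  moreover have "1 - rk (N - 1) = - L.\<tau> (-1)"
  proof -
    have "rk (N - 1) = L.\<tau> (real (N - 1))"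
      using rk[OF N1(2)] L.tau_Phi[of "rk (N - 1)"] by simp
    also have "real (N - 1) = - 1 + of_int (1 * int N)" using N_ge_2 by simp
    also have "L.\<tau> (- 1 + of_int (1 * int N)) = L.\<tau> (- 1) + 1"
      using L.tau_add_int[of "- 1" 1] by simp
    finally show ?thesis by simp
  qed
  ultimately have r_eq: "r = min (L.\<tau> 1) (- L.\<tau> (-1))" by (simp add: r)
  have r_pos: "0 < r"
    unfolding r_eq using L.tau_less_iff[of 0 1] L.tau_less_iff[of "-1" 0] by simp
  have D_pos: "0 < D (turn x)" if "\<bar>x\<bar> < r" for x
    using u_nonzero[OF that] by (simp add: D)
  have D_log: "\<exists>C>0. \<exists>\<delta>>0. \<forall>x. \<bar>x\<bar> < \<delta> \<longrightarrow> exp (- C * \<bar>x\<bar>) \<le> D (turn x)"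
  proof -
    obtain C where C: "C > 0"
      "\<forall>\<^sub>F x in at 0. norm (ln ((cmod (u (turn x)))\<^sup>2)) \<le> C * norm x"
      using landau_o.bigE[OF u_log] by blast
    obtain d where d: "d > 0"
      "\<And>x. x \<noteq> 0 \<Longrightarrow> \<bar>x\<bar> < d \<Longrightarrow> \<bar>ln (D (turn x))\<bar> \<le> C * \<bar>x\<bar>"
      using C(2) by (auto simp: eventually_at dist_real_def D)
    have "exp (- C * \<bar>x\<bar>) \<le> D (turn x)" if "\<bar>x\<bar> < min d r" for x
    proof (cases "x = 0")
      case True
      then show ?thesis by (simp add: D u_one)
    next
      case False
      then have "- C * \<bar>x\<bar> \<le> ln (D (turn x))" using d(2)[of x] that by simp
      then have "exp (- C * \<bar>x\<bar>) \<le> exp (ln (D (turn x)))" by (simp only: exp_le_cancel_iff)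
      then show ?thesis using D_pos[of x] that by simp
    qed
    moreover have "min d r > 0" using d(1) r_pos by simp
    ultimately show ?thesis using C(1) by blast
  qed
  have m_turn_cont: "continuous_on UNIV (\<lambda>x. m (turn x))"
    by (rule continuous_on_compose2[OF m_cont continuous_on_turn]) auto
  have D_turn_cont: "continuous_on UNIV (\<lambda>x. D (turn x))"
  proof -
    have "continuous_on UNIV (\<lambda>x. (cmod (m (turn x)))\<^sup>2 / \<phi> x)"
      using phi_pos by (intro continuous_intros m_turn_cont phi_cont) (metis less_irrefl)
    moreover have "(cmod (m (turn x)))\<^sup>2 / \<phi> x = D (turn x)" for x
      using phi_pos[of x] by (simp add: m_sq)
    ultimately show ?thesis by simp
  qed
  interpret S: weighted_solenoid \<phi> N \<sigma> D \<nu>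
  proof unfold_locales
    show "(\<Sum>w\<in>preimages \<sigma> z. D w) = 1" if "z \<in> circle" for z
    proof -
      have "(\<Sum>w\<in>preimages \<sigma> z. D w) = (\<Sum>w\<in>preimages \<sigma> z. \<psi> w * (cmod (m w))\<^sup>2)"
        by (intro sum.cong refl D_psi) (simp add: preimages_def)
      then show ?thesis using filter that by (simp add: psi_filter_def)
    qed
    show "D (turn x) \<noteq> 0" if "\<bar>x\<bar> < min (L.\<tau> 1) (- L.\<tau> (-1))" for x
      using D_pos[of x] that by (simp add: r_eq)
  qed (use sigma D D_turn_cont D_log nu in simp_all)
  have mu: "\<mu>_inf = S.\<mu>_sol" by (simp add: mu_inf S.\<mu>_sol_def)
  have U: "U_tilde \<mu>_inf \<sigma> m = comp_op \<mu>_inf (\<lambda>\<zeta>. m (solenoid_proj \<zeta>)) (solenoid_map \<sigma>)"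
    by (simp add: fun_eq_iff U_tilde_def comp_op_def)
  have U_line: "U_line \<phi> = comp_op lborel (\<lambda>x. complex_of_real (sqrt (\<phi> x))) (primitive \<phi>)"
    by (simp add: fun_eq_iff U_line_def comp_op_def)
  have trU: "transports \<mu>_inf \<mu>_inf (\<lambda>\<zeta>. m (solenoid_proj \<zeta>)) (solenoid_map \<sigma>)"
    unfolding mu by (rule S.transports_solenoid_map[OF m_cont m_sq])

  \<comment> \<open>Only the phase of \<open>u\<close> matters here; the value \<open>1\<close> at its zeros keeps \<open>s\<close> unimodular.\<close>
  define s where "s x = (if u (turn x) = 0 then 1 else sgn (u (turn x)))" for x
  have u_turn_meas [measurable]: "(\<lambda>x. u (turn x)) \<in> borel_measurable borel"
    unfolding u using borel_measurable_continuous_onI[OF m_turn_cont] L.phi_measurable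
    by measurable
  have s_meas: "s \<in> borel_measurable borel" unfolding s_def by measurable
  have s_norm: "cmod (s x) = 1" for x by (simp add: s_def norm_sgn)
  obtain \<theta> where \<theta>: "\<theta> \<in> borel_measurable borel" "\<And>x. x \<noteq> 0 \<Longrightarrow> cmod (\<theta> x) = 1"
    "\<And>x. x \<noteq> 0 \<Longrightarrow> \<theta> (primitive \<phi> x) = s x * \<theta> x"
    using L.unimodular_cocycle_trivial[OF s_meas s_norm] by blast
  define F where "F x = complex_of_real (sqrt (S.mass x)) * \<theta> x" for x
  have F_meas: "F \<in> borel_measurable borel"
    unfolding F_def using S.mass_measurable \<theta>(1) by measurable
  have F_sq: "(cmod (F x))\<^sup>2 = S.mass x" if "x \<noteq> 0" for x
    using \<theta>(2)[OF that] S.mass_nonneg[of x] by (simp add: F_def norm_mult power_mult_distrib)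
  have F_Phi: "F (primitive \<phi> x) = u (turn x) * F x" if "x \<noteq> 0" for x
  proof -
    have "sqrt (S.mass (primitive \<phi> x)) = cmod (u (turn x)) * sqrt (S.mass x)"
      unfolding S.mass_Phi by (simp add: D real_sqrt_mult)
    moreover have "complex_of_real (cmod (u (turn x))) * s x = u (turn x)"
      by (simp add: s_def sgn_eq)
    ultimately show ?thesis using \<theta>(3)[OF that] by (simp add: F_def mult_ac)
  qed
  have trF: "transports \<mu>_inf lborel F S.line_path"
    unfolding mu by (rule S.transports_line_path[OF F_meas F_sq])

  \<comment> \<open>Surjectivity of the given unitary is what excludes zeros of \<open>m\<close>, and hence of \<open>F\<close>, on a set of positive measure.\<close>
  have "comp_op \<mu>_inf (\<lambda>\<zeta>. m (solenoid_proj \<zeta>)) (solenoid_map \<sigma>) ` L2 \<mu>_inf = L2 \<mu>_inf"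
    using U_tilde_unitary by (simp add: L2_unitary_def L2_isometric_iso_def bij_betw_def U)
  then have "AE \<zeta> in \<mu>_inf. m (solenoid_proj \<zeta>) \<noteq> 0"
    using S.prob_space_mu_sol by (intro comp_op_surj_nonzero) (simp_all add: mu)
  then have "AE x in lborel. F x \<noteq> 0 \<longrightarrow> m (solenoid_proj (S.line_path x)) \<noteq> 0"
    by (rule transports_AE[OF trF])
  then have "AE x in lborel. S.mass x \<noteq> 0 \<longrightarrow> D (turn x) \<noteq> 0"
    using AE_lborel_singleton[of 0]
  proof eventually_elim
    case (elim x)
    then show ?case
      using F_sq[of x] m_sq[of x] unfolding solenoid_proj_def S.line_path_0 by auto
  qed
  then have "AE x in lborel. 0 < S.mass x"
    by (intro S.mass_pos_AE S.D_nonzero_AE)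
  then have F_nz: "AE x in lborel. F x \<noteq> 0"
    using AE_lborel_singleton[of 0] by eventually_elim (use F_sq in force)

  define R where "R = comp_op lborel F S.line_path"
  have "S.line_coord \<in> \<mu>_inf \<rightarrow>\<^sub>M lborel"
    using S.measurable_mu_sol[OF S.line_coord_measurable] by (simp add: mu)
  then have R_iso: "L2_isometric_iso \<mu>_inf lborel R"
    unfolding R_def by (rule comp_op_isometric_iso[OF trF F_nz]) simp
  have R_intertwines: "R (U_tilde \<mu>_inf \<sigma> m A) = U_line \<phi> (R A)" if "A \<in> L2 \<mu>_inf" for A
    unfolding U U_line R_def
  proof (rule comp_op_intertwine[OF trU trF L.transports_Phi _ _ that])
    show "AE x in lborel. F x * m (solenoid_proj (S.line_path x))
        = complex_of_real (sqrt (\<phi> x)) * F (primitive \<phi> x)"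
      using AE_lborel_singleton[of 0]
    proof eventually_elim
      case (elim x)
      have "complex_of_real (sqrt (\<phi> x)) * u (turn x) = m (turn x)"
        using phi_pos[of x] by (simp add: u)
      then show ?case
        unfolding solenoid_proj_def S.line_path_0 F_Phi[OF elim] by (metis mult.assoc mult.commute)
    qed
    show "solenoid_map \<sigma> (S.line_path x) = S.line_path (primitive \<phi> x)" for x
      by (rule S.solenoid_map_line_path)
  qed
  have "L2_unitary lborel (U_line \<phi>)"
    unfolding L2_unitary_def U_line
  proof (rule comp_op_isometric_iso[OF L.transports_Phi])
    show "AE x in lborel. complex_of_real (sqrt (\<phi> x)) \<noteq> 0"
      using phi_pos by (intro AE_I2) (simp add: less_imp_neq[symmetric])
    show "L.\<tau> \<in> lborel \<rightarrow>\<^sub>M lborel" by simp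
  qed simp
  with R_iso R_intertwines show ?thesis by blast
qed

end
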